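(* Let $f:\mathbb{R}^n\to(-\infty,\infty]$ be proper, lower semicontinuous and prox-bounded with threshold $\lambda_f>0$, and let $g:\mathbb{R}^n\to\mathbb{R}$ be differentiable with Lipschitz continuous gradient with constant $L>0$. Put $F=f+g$, and assume $\inf F>-\infty$ and $0<\lambda<\min\{\frac{1}{4L},\lambda_f\}$. Let $(x_k)_{k\geq -1}$ be a sequence generated by the FRB method with step-size $\lambda$, put $z_k=(x_{k+1},x_k)$ for $k\ge -1$, and assume that $(z_k)_{k\ge -1}$ is bounded. Let $\omega(z_{-1})$ be the set of limit points of $(z_k)_{k\ge-1}$, and suppose that the FRB merit function $H$ has the generalized concave Kurdyka-Łojasiewicz property on $\omega(z_{-1})$. Then: (i) The sequence $(z_k)_{k\geq-1}$ is Cauchy and has finite length, i.e. $\sum_{k=-1}^\infty\|z_{k+1}-z_k\|<\infty$. More specifically, writing $z^*$ for the limit of $(z_k)$, there exist $M>0$, $k_0\in\mathbb{N}$, $\varepsilon>0$ and $\eta\in(0,\infty]$ such that for all $i\geq k_0+1$, $$\sum_{k=i}^\infty\|z_{k+1}-z_k\|\leq\|z_i-z_{i-1}\|+M\tilde\varphi\big(H(z_i)-H(z^* )\big),$$ where $\tilde\varphi\in\Phi_\eta$ is the exact modulus associated with the setwise generalized concave KL property of $H$ on $\omega(z_{-1})$ with respect to $\varepsilon$ and $\eta$. (ii) The sequence $(x_k)_{k\ge-1}$ has finite length, i.e. $\sum_{k=-1}^\infty\|x_{k+1}-x_k\|<\infty$, and converges to some $x^*\in\mathbb{R}^n$ with $0\in\partial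 F(x^* )$.
   Context: $\mathbb{N}=\{0,1,2,\dots\}$; norms are Euclidean, and $\|(x,y)\|=\sqrt{\|x\|^2+\|y\|^2}$ on $\mathbb{R}^n\times\mathbb{R}^n$. A proper lsc $f$ is prox-bounded if $f+\frac{1}{2\lambda}\|\cdot\|^2$ is bounded below for some $\lambda>0$; the supremum $\lambda_f\in(0,\infty]$ of all such $\lambda$ is its threshold. $\mathrm{Prox}_{\lambda f}(x)=\operatorname{argmin}_{y}\{f(y)+\frac{1}{2\lambda}\|x-y\|^2\}$ (a set). FRB method: given arbitrary $x_{-1},x_0\in\mathbb{R}^n$ and $\lambda>0$, for $k=0,1,2,\dots$ let $y_k=x_k+\lambda(\nabla g(x_{k-1})-\nabla g(x_k))$ and choose $x_{k+1}\in\mathrm{Prox}_{\lambda f}(y_k-\lambda\nabla g(x_k))$. FRB merit function: $H(x,y)=f(x)+g(x)+\frac{1}{4\lambda}\|x-y\|^2$ on $\mathbb{R}^n\times\mathbb{R}^n$. Subdifferentials: for a proper function $h$ and $\bar x\in\operatorname{dom}h$, $v\in\hat\partial h(\bar x)$ (Fréchet) if $h(x)\ge h(\bar x)+\langle v,x-\bar x\rangle+o(\|x-\bar x\|)$; $v\in\partial h(\bar x)$ (limiting) if there are $x_k\to\bar x$ with $h(x_k)\to h(\bar x)$ and $v_k\in\hat\partial h(x_k)$ with $v_k\to v$. $\partial h(x)=\emptyset$ for $x\notin\operatorname{dom}h$; $\operatorname{dom}\partial h=\{x:\partial h(x)\ne\emptyset\}$; $\operatorname{dist}(x,\emptyset)=\infty$.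 $[a<h<b]=\{x:a<h(x)<b\}$. For $\eta\in(0,\infty]$, $\Phi_\eta$ is the class of functions $\varphi:[0,\eta)\to[0,\infty)$ that are right-continuous at $0$ with $\varphi(0)=0$ and strictly increasing on $[0,\eta)$. Let $h$ be proper lsc and $V\subseteq\operatorname{dom}\partial h$ nonempty with $h=\mu$ on $V$. Then $h$ has the (setwise) generalized concave Kurdyka-Łojasiewicz (KL) property on $V$ if there exist an open set $U\supseteq V$, $\eta\in(0,\infty]$ and a concave $\varphi\in\Phi_\eta$ such that for every $x\in U\cap[0<h-\mu<\eta]$, $\varphi'_-(h(x)-\mu)\cdot\operatorname{dist}(0,\partial h(x))\ge1$, where $\varphi'_-$ is the left derivative; such $\varphi$ is called a concave desingularizing function of $h$ on $V$ with respect to $U$ and $\eta$. "With respect to $\varepsilon$ and $\eta$" means with $U=V_\varepsilon=\{x:\operatorname{dist}(x,V)<\varepsilon\}$. Exact modulus: when $V$ is compact and $h$ has the setwise generalized concave KL property on $V$ with respect to $U=V_\varepsilon$ and $\eta$, the exact modulus is $\tilde\varphi:[0,\eta)\to[0,\infty)$, $\tilde\varphi(0)=0$, $\tilde\varphi(t)=\int_0^t \rho(s)\,ds$ for $t\in(0,\eta)$, where $\rho(s)=\sup\{\operatorname{dist}^{-1}(0,\partial h(x)):x\in U\cap[0<h-\mu<\eta],\ s\le h(x)-\mu\}$. It is the infimum of all concave desingularizing functions of $h$ on $V$ with respect to $U$ and $\eta$. (In the situation of the theorem, $\omega(z_{-1})$ is nonempty and compact, is contained in $\operatorname{dom}\partial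 H$, and $H$ is constant on it, so these notions apply to $H$ and $\omega(z_{-1})$.) *)

theory Defs
  imports "HOL-Analysis.Analysis" "HOL-Library.Landau_Symbols"
begin

section \<open>Extended-real-valued functions and subdifferentials\<close>

definition proper :: "('a \<Rightarrow> ereal) \<Rightarrow> bool" where
  "proper h \<longleftrightarrow> (\<forall>x. h x \<noteq> -\<infinity>) \<and> (\<exists>x. h x \<noteq> \<infinity>)"

definition lsc :: "('a::topological_space \<Rightarrow> ereal) \<Rightarrow> bool" where
  "lsc h \<longleftrightarrow> (\<forall>x. h x \<le> Liminf (at x) h)"

definition prox_params :: "('a::real_normed_vector \<Rightarrow> ereal) \<Rightarrow> real set" where
  "prox_params f = {lam. lam > 0 \<and> (INF y. f y + ereal (1 / (2 * lam) * (norm y)\<^sup>2)) > -\<infinity>}"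

definition prox_bounded :: "('a::real_normed_vector \<Rightarrow> ereal) \<Rightarrow> bool" where
  "prox_bounded f \<longleftrightarrow> prox_params f \<noteq> {}"

definition prox_threshold :: "('a::real_normed_vector \<Rightarrow> ereal) \<Rightarrow> ereal" where
  "prox_threshold f = (SUP lam\<in>prox_params f. ereal lam)"

definition prox :: "real \<Rightarrow> ('a::real_normed_vector \<Rightarrow> ereal) \<Rightarrow> 'a \<Rightarrow> 'a set" where
  "prox lam f x =
     {y. is_arg_min (\<lambda>w. f w + ereal (1 / (2 * lam) * (norm (x - w))\<^sup>2)) (\<lambda>_. True) y}"

definition frechet_subdiff :: "('a::real_inner \<Rightarrow> ereal) \<Rightarrow> 'a \<Rightarrow> 'a set" where
  "frechet_subdiff h x =
     {v. h x < \<infinity> \<and>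
         (\<exists>r. r \<in> o[at x](\<lambda>y. norm (y - x)) \<and>
              (\<forall>\<^sub>F y in at x. h x + ereal (v \<bullet> (y - x) + r y) \<le> h y))}"

definition limiting_subdiff :: "('a::real_inner \<Rightarrow> ereal) \<Rightarrow> 'a \<Rightarrow> 'a set" where
  "limiting_subdiff h x =
     {v. h x < \<infinity> \<and>
         (\<exists>xs vs. xs \<longlonglongrightarrow> x \<and> (\<lambda>k. h (xs k)) \<longlonglongrightarrow> h x \<and>
                  (\<forall>k. vs k \<in> frechet_subdiff h (xs k)) \<and> vs \<longlonglongrightarrow> v)}"

text \<open>Unlike the library's \<^const>\<open>infdist\<close>, this distance is infinite for the empty set.\<close>

definition edist_set :: "'a::metric_space \<Rightarrow> 'a set \<Rightarrow> ennreal" where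
  "edist_set x A = (INF a\<in>A. ennreal (dist x a))"

definition nbhd :: "real \<Rightarrow> 'a::metric_space set \<Rightarrow> 'a set" where
  "nbhd \<epsilon> V = {x. edist_set x V < ennreal \<epsilon>}"

section \<open>The setwise generalized concave Kurdyka-Lojasiewicz property\<close>

definition hopen :: "ereal \<Rightarrow> real set" where
  "hopen \<eta> = {t. 0 \<le> t \<and> ereal t < \<eta>}"

text \<open>Functions on \<open>[0, \<eta>)\<close> are represented by total functions on the reals;
  values outside \<^term>\<open>hopen \<eta>\<close> are irrelevant.\<close>

definition Phi :: "ereal \<Rightarrow> (real \<Rightarrow> real) set" where
  "Phi \<eta> = {\<phi>. (\<forall>t\<in>hopen \<eta>. 0 \<le> \<phi> t) \<and> \<phi> 0 = 0 \<and>
                continuous (at_right 0) \<phi> \<and> strict_mono_on (hopen \<eta>) \<phi>}"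

text \<open>The value \<open>\<mu>\<close> with \<open>h = \<mu>\<close> on \<open>V\<close>. It is meaningful only if \<open>V\<close> is nonempty and \<open>h\<close> is
  constant and finite on \<open>V\<close>. These standing conditions (and \<open>V \<subseteq> dom \<partial>h\<close>) are not made part of
  the predicates below, so that a theorem assuming \<open>has_gckl\<close> does not assume them silently.\<close>

definition level_value :: "('a \<Rightarrow> ereal) \<Rightarrow> 'a set \<Rightarrow> real" where
  "level_value h V = (THE \<mu>. \<forall>x\<in>V. h x = ereal \<mu>)"

lemma level_value_eq:
  assumes "V \<noteq> {}" and "\<forall>x\<in>V. h x = ereal \<mu>"
  shows "level_value h V = \<mu>"
  unfolding level_value_def using assms by (intro the_equality) auto

definition level_slice :: "('a \<Rightarrow> ereal) \<Rightarrow> 'a set \<Rightarrow> 'a set \<Rightarrow> ereal \<Rightarrow> 'a set" where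
  "level_slice h V U \<eta> =
     {x\<in>U. 0 < h x - ereal (level_value h V) \<and> h x - ereal (level_value h V) < \<eta>}"

definition concave_desingularizing ::
    "('a::real_inner \<Rightarrow> ereal) \<Rightarrow> 'a set \<Rightarrow> 'a set \<Rightarrow> ereal \<Rightarrow> (real \<Rightarrow> real) \<Rightarrow> bool" where
  "concave_desingularizing h V U \<eta> \<phi> \<longleftrightarrow>
     \<phi> \<in> Phi \<eta> \<and> concave_on (hopen \<eta>) \<phi> \<and>
     (\<forall>x\<in>level_slice h V U \<eta>.
        ennreal (vector_derivative \<phi> (at_left (real_of_ereal (h x - ereal (level_value h V)))))
          * edist_set 0 (limiting_subdiff h x) \<ge> 1)"

definition has_gckl_wrt ::
    "('a::real_inner \<Rightarrow> ereal) \<Rightarrow> 'a set \<Rightarrow> 'a set \<Rightarrow> ereal \<Rightarrow> bool" where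
  "has_gckl_wrt h V U \<eta> \<longleftrightarrow>
     open U \<and> V \<subseteq> U \<and> \<eta> > 0 \<and> (\<exists>\<phi>. concave_desingularizing h V U \<eta> \<phi>)"

definition has_gckl :: "('a::real_inner \<Rightarrow> ereal) \<Rightarrow> 'a set \<Rightarrow> bool" where
  "has_gckl h V \<longleftrightarrow> (\<exists>U \<eta>. has_gckl_wrt h V U \<eta>)"

text \<open>In \<^typ>\<open>ennreal\<close> the inverse of \<open>\<infinity>\<close> is \<open>0\<close> and the supremum of the empty set is \<open>0\<close>.\<close>

definition modulus_density ::
    "('a::real_inner \<Rightarrow> ereal) \<Rightarrow> 'a set \<Rightarrow> 'a set \<Rightarrow> ereal \<Rightarrow> real \<Rightarrow> ennreal" where
  "modulus_density h V U \<eta> s =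
     (SUP x\<in>{x\<in>level_slice h V U \<eta>. ereal s \<le> h x - ereal (level_value h V)}.
        inverse (edist_set 0 (limiting_subdiff h x)))"

definition exact_modulus ::
    "('a::real_inner \<Rightarrow> ereal) \<Rightarrow> 'a set \<Rightarrow> real \<Rightarrow> ereal \<Rightarrow> real \<Rightarrow> real" where
  "exact_modulus h V \<epsilon> \<eta> t =
     enn2real (\<integral>\<^sup>+s\<in>{0<..<t}. modulus_density h V (nbhd \<epsilon> V) \<eta> s \<partial>lborel)"

section \<open>The forward-reflected-backward method\<close>

text \<open>Sequences \<open>(x\<^sub>k)\<close> with \<open>k \<ge> -1\<close> are indexed by integers; values at \<open>k < -1\<close> are irrelevant.\<close>

definition frb_sequence ::
    "('a::real_normed_vector \<Rightarrow> ereal) \<Rightarrow> ('a \<Rightarrow> 'a) \<Rightarrow> real \<Rightarrow> (int \<Rightarrow> 'a) \<Rightarrow> bool" where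
  "frb_sequence f Dg lam x \<longleftrightarrow>
     (\<forall>k\<ge>0. let y = x k + lam *\<^sub>R (Dg (x (k - 1)) - Dg (x k))
             in x (k + 1) \<in> prox lam f (y - lam *\<^sub>R Dg (x k)))"

definition frb_merit ::
    "('a::real_normed_vector \<Rightarrow> ereal) \<Rightarrow> ('a \<Rightarrow> real) \<Rightarrow> real \<Rightarrow> 'a \<times> 'a \<Rightarrow> ereal" where
  "frb_merit f g lam = (\<lambda>(x, y). f x + ereal (g x) + ereal (1 / (4 * lam) * (norm (x - y))\<^sup>2))"

definition limit_points :: "(int \<Rightarrow> 'a::topological_space) \<Rightarrow> 'a set" where
  "limit_points z =
     {w. \<exists>r. strict_mono r \<and> (\<forall>j. r j \<ge> -1) \<and> (\<lambda>j::nat. z (r j)) \<longlonglongrightarrow> w}"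

end

theory Submission
  imports Defs
begin

text \<open>Comparing \<open>x\<^sub>k\<^sub>+\<^sub>1\<close> with \<open>x\<^sub>k\<close> in the proximal step shows that \<open>H\<close> decreases along \<open>(z\<^sub>k)\<close> by at least
  \<open>c \<parallel>z\<^sub>k - z\<^sub>k\<^sub>-\<^sub>1\<parallel>\<^sup>2\<close> with \<open>c = 1 / (4 \<lambda>) - L\<close>, and the optimality of \<open>x\<^sub>k\<^sub>+\<^sub>1\<close> gives a subgradient of \<open>H\<close> at \<open>z\<^sub>k\<close> of norm
  at most \<open>K \<parallel>z\<^sub>k - z\<^sub>k\<^sub>-\<^sub>1\<parallel>\<close>. Hence \<open>(z\<^sub>k)\<close> eventually lies in the region of the KL inequality. The density of
  the exact modulus is nonincreasing and at \<open>H (z\<^sub>k) - \<mu>\<close> it is at least the inverse of that norm, so with \<open>M = K / c\<close>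
  the square of \<open>\<parallel>z\<^sub>k\<^sub>+\<^sub>1 - z\<^sub>k\<parallel>\<close> is at most \<open>\<parallel>z\<^sub>k - z\<^sub>k\<^sub>-\<^sub>1\<parallel>\<close> times the decrease of \<open>M\<close> times the modulus. By the
  inequality of arithmetic and geometric means this telescopes to the length bound.\<close>

section \<open>Concave functions and the exact modulus\<close>

text \<open>\<open>vector_derivative\<close> is meaningful only if the left derivative exists, so
  existence comes first. By concavity the slopes of chords ending at \<open>t\<close> decrease as
  the left endpoint approaches \<open>t\<close>; by monotonicity they are nonnegative. Hence they
  converge to their infimum, which the slope from \<open>a\<close> bounds.\<close>

lemma concave_left_derivative_le:
  fixes \<phi> :: "real \<Rightarrow> real"
  assumes conc: "concave_on S \<phi>" and sub: "{a..t} \<subseteq> S" and "a < t" and mono: "mono_on {a..t} \<phi>"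
  shows "vector_derivative \<phi> (at_left t) \<le> (\<phi> t - \<phi> a) / (t - a)"
proof -
  \<comment> \<open>The sign is flipped because \<open>Lim_left_bound\<close> treats increasing
    functions that are bounded above.\<close>
  define q where "q y = - ((\<phi> t - \<phi> y) / (t - y))" for y
  define I where "I = {..<t} \<inter> {a..<t}"
  have I: "I = {a..<t}" unfolding I_def by auto
  have q_mono: "q y \<le> q y'" if "y \<in> {a..<t}" "y' \<in> {a..<t}" "y' < t" "y \<le> y'" for y y'
  proof (cases "y = y'")
    case False
    have cvx: "convex_on S (\<lambda>x. - \<phi> x)" using conc by (simp add: concave_on_def)
    have "(- \<phi> y - - \<phi> t) / (y - t) \<le> (- \<phi> y' - - \<phi> t) / (y' - t)"
      by (rule convex_on_slope_le(2)[OF cvx]) (use that False sub in auto)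
    moreover have "(- \<phi> u - - \<phi> t) / (u - t) = q u" for u
      unfolding q_def by (smt (verit) minus_divide_left minus_divide_right)
    ultimately show ?thesis by simp
  qed auto
  have q_le: "q y \<le> 0" if "y \<in> {a..<t}" for y
    unfolding q_def using that monotone_onD[OF mono, of y t] by auto
  define D where "D = Sup (q ` I)"
  have "(q \<longlongrightarrow> D) (at t within I)"
    unfolding D_def I_def using q_mono q_le by (intro Lim_left_bound[where K = 0]) auto
  then have "((\<lambda>y. - q y) \<longlongrightarrow> - D) (at t within I)" by (rule tendsto_minus)
  moreover have "- q y = (\<phi> y - \<phi> t) / (y - t)" for y
    unfolding q_def by (smt (verit) minus_divide_left minus_divide_right)
  ultimately have "(\<phi> has_field_derivative - D) (at t within I)"
    by (simp add: has_field_derivative_iff)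
  moreover have "at t within I = at_left t"
    unfolding I by (rule at_within_nhd[of _ "{a<..}"]) (use \<open>a < t\<close> in auto)
  ultimately have "(\<phi> has_vector_derivative - D) (at_left t)"
    by (simp add: has_real_derivative_iff_has_vector_derivative)
  then have "vector_derivative \<phi> (at_left t) = - D"
    by (intro vector_derivative_within) auto
  moreover have "q a \<le> D"
    unfolding D_def I using \<open>a < t\<close> q_le by (intro cSup_upper) (auto intro!: bdd_aboveI2[where M = 0])
  ultimately show ?thesis by (simp add: q_def)
qed

text \<open>Multiplied by \<open>\<delta>\<close> and integrated, the slope bound telescopes after a translation by \<open>\<delta>\<close>.\<close>

lemma nn_integral_le_of_le_slope_shift:
  fixes \<phi> :: "real \<Rightarrow> real" and \<rho> :: "real \<Rightarrow> ennreal"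
  assumes meas [measurable]: "\<rho> \<in> borel_measurable borel"
    and mono: "mono_on {0..t} \<phi>" and nonneg: "0 \<le> \<phi> 0" and \<delta>: "0 < \<delta>" "\<delta> < t"
    and slope: "\<And>s. \<delta> < s \<Longrightarrow> s < t \<Longrightarrow> \<rho> s \<le> ennreal ((\<phi> s - \<phi> (s - \<delta>)) / \<delta>)"
  shows "(\<integral>\<^sup>+s\<in>{\<delta><..<t}. \<rho> s \<partial>lborel) \<le> ennreal (\<phi> t)"
proof -
  \<comment> \<open>Freezing \<open>\<phi>\<close> outside the interval makes it monotone on the
    whole line, hence Borel measurable.\<close>
  define \<Phi> where "\<Phi> s = \<phi> (max 0 (min s t))" for s
  have \<Phi>_mono: "mono \<Phi>"
    unfolding \<Phi>_def using \<delta> by (intro monoI monotone_onD[OF mono]) auto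
  have [measurable]: "\<Phi> \<in> borel_measurable borel" by (rule borel_measurable_mono[OF \<Phi>_mono])
  have \<Phi>_eq: "\<Phi> s = \<phi> s" if "0 \<le> s" "s \<le> t" for s using that by (simp add: \<Phi>_def)
  have \<Phi>_nonneg: "0 \<le> \<Phi> s" for s
    unfolding \<Phi>_def using \<delta> monotone_onD[OF mono, of 0 "max 0 (min s t)"] nonneg by auto
  have \<Phi>_le: "\<Phi> s \<le> \<phi> t" for s
    unfolding \<Phi>_def using \<delta> by (intro monotone_onD[OF mono]) auto
  let ?R = "\<integral>\<^sup>+s. \<rho> s * indicator {\<delta><..<t} s \<partial>lborel"
  let ?B = "\<integral>\<^sup>+s. ennreal (\<Phi> s) * indicator {0<..<t - \<delta>} s \<partial>lborel"
  have shift: "?B = (\<integral>\<^sup>+s. ennreal (\<Phi> (s - \<delta>)) * indicator {\<delta><..<t} s \<partial>lborel)"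
    by (subst nn_integral_real_affine[where c = 1 and t = "- \<delta>"])
       (auto simp: indicator_def intro!: nn_integral_cong)
  have pointwise: "ennreal \<delta> * \<rho> s + ennreal (\<Phi> (s - \<delta>)) \<le> ennreal (\<Phi> s)" if "\<delta> < s" "s < t" for s
  proof -
    have diff: "0 \<le> \<Phi> s - \<Phi> (s - \<delta>)" using \<delta> monoD[OF \<Phi>_mono, of "s - \<delta>" s] by simp
    have "ennreal \<delta> * \<rho> s \<le> ennreal \<delta> * ennreal ((\<phi> s - \<phi> (s - \<delta>)) / \<delta>)"
      by (intro mult_left_mono slope that) auto
    also have "\<dots> = ennreal (\<Phi> s - \<Phi> (s - \<delta>))"
      using \<delta> that diff by (simp add: \<Phi>_eq flip: ennreal_mult)
    finally have "ennreal \<delta> * \<rho> s + ennreal (\<Phi> (s - \<delta>)) \<le> ennreal (\<Phi> s - \<Phi> (s - \<delta>)) + ennreal (\<Phi> (s - \<delta>))"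
      by (rule add_right_mono)
    then show ?thesis using \<Phi>_nonneg diff by (simp flip: ennreal_plus)
  qed
  have "ennreal \<delta> * ?R + ?B
      = (\<integral>\<^sup>+s. (ennreal \<delta> * \<rho> s + ennreal (\<Phi> (s - \<delta>))) * indicator {\<delta><..<t} s \<partial>lborel)"
    unfolding shift
    by (subst nn_integral_cmult[symmetric], simp, subst nn_integral_add[symmetric])
       (auto simp: algebra_simps intro!: nn_integral_cong)
  \<comment> \<open>Below \<open>t - \<delta>\<close> the bound is the integrand of
    \<open>?B\<close>; the remaining strip of length \<open>\<delta>\<close> contributes at most
    \<open>\<delta>\<close> times \<open>\<phi> t\<close>.\<close>
  also have "\<dots> \<le> (\<integral>\<^sup>+s. ennreal (\<Phi> s) * indicator {0<..<t - \<delta>} s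
      + ennreal (\<phi> t) * indicator {t - \<delta>..<t} s \<partial>lborel)"
  proof (rule nn_integral_mono)
    fix s
    have "ennreal (\<Phi> s) \<le> ennreal (\<phi> t)" by (intro ennreal_leI \<Phi>_le)
    then show "(ennreal \<delta> * \<rho> s + ennreal (\<Phi> (s - \<delta>))) * indicator {\<delta><..<t} s
        \<le> ennreal (\<Phi> s) * indicator {0<..<t - \<delta>} s + ennreal (\<phi> t) * indicator {t - \<delta>..<t} s"
      using pointwise[of s] \<delta> by (auto simp: indicator_def)
  qed
  also have "\<dots> = ?B + ennreal (\<phi> t) * ennreal \<delta>"
    using \<delta> by (subst nn_integral_add) (auto simp: nn_integral_cmult)
  finally have le: "ennreal \<delta> * ?R + ?B \<le> ennreal \<delta> * ennreal (\<phi> t) + ?B"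
    by (simp add: ac_simps)
  \<comment> \<open>Cancelling \<open>?B\<close> in \<open>ennreal\<close> requires that it be
    finite.\<close>
  have "?B \<le> (\<integral>\<^sup>+s. ennreal (\<phi> t) * indicator {0<..<t - \<delta>} s \<partial>lborel)"
    by (intro nn_integral_mono) (auto simp: indicator_def intro!: ennreal_leI \<Phi>_le)
  also have "\<dots> < \<infinity>"
    using \<delta> by (simp add: nn_integral_cmult ennreal_mult_less_top)
  finally have "?B \<noteq> \<infinity>" by simp
  with le have "ennreal \<delta> * ?R \<le> ennreal \<delta> * ennreal (\<phi> t)"
    by (simp add: ennreal_add_left_cancel_le add.commute[of _ ?B])
  then show ?thesis
    using \<delta> by (simp add: ennreal_mult_le_mult_iff)
qed

text \<open>Monotone convergence over intervals whose left end \<open>t / (n + 2)\<close> serves as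
  the shift; the \<open>+ 2\<close> keeps it strictly below \<open>t\<close>.\<close>

lemma nn_integral_le_of_le_slope:
  fixes \<phi> :: "real \<Rightarrow> real" and \<rho> :: "real \<Rightarrow> ennreal"
  assumes meas [measurable]: "\<rho> \<in> borel_measurable borel"
    and mono: "mono_on {0..t} \<phi>" and nonneg: "0 \<le> \<phi> 0"
    and slope: "\<And>\<delta> s. 0 < \<delta> \<Longrightarrow> \<delta> < s \<Longrightarrow> s < t \<Longrightarrow> \<rho> s \<le> ennreal ((\<phi> s - \<phi> (s - \<delta>)) / \<delta>)"
  shows "(\<integral>\<^sup>+s\<in>{0<..<t}. \<rho> s \<partial>lborel) \<le> ennreal (\<phi> t)"
proof (cases "0 < t")
  case True
  define A where "A n = {t / (real n + 2)<..<t}" for n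
  have A_inc: "incseq A"
    unfolding A_def using True
    by (intro incseq_SucI) (auto intro!: divide_left_mono elim!: le_less_trans[rotated])
  have A_Un: "(\<Union>n. A n) = {0<..<t}"
  proof (intro equalityI subsetI)
    fix s assume s: "s \<in> {0<..<t}"
    then obtain n where "t / s < real n" using reals_Archimedean2 by blast
    with s have "t / (real n + 2) < s" by (auto simp: field_simps)
    with s show "s \<in> (\<Union>n. A n)" by (auto simp: A_def)
  next
    fix s assume "s \<in> (\<Union>n. A n)"
    then obtain n where "t / (real n + 2) < s" "s < t" by (auto simp: A_def)
    moreover have "0 < t / (real n + 2)" using True by (intro divide_pos_pos) auto
    ultimately show "s \<in> {0<..<t}" by simp
  qed
  have ind: "(SUP n. \<rho> s * indicator (A n) s) = \<rho> s * indicator {0<..<t} s" for s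
  proof (cases "s \<in> {0<..<t}")
    case True
    then obtain n where "s \<in> A n" using A_Un by blast
    then have "\<rho> s \<le> (SUP n. \<rho> s * indicator (A n) s)" by (intro SUP_upper2[of n]) auto
    moreover have "(SUP n. \<rho> s * indicator (A n) s) \<le> \<rho> s"
      by (intro SUP_least) (auto simp: indicator_def)
    ultimately show ?thesis using True by simp
  next
    case False
    then have "s \<notin> A n" for n using A_Un by blast
    with False show ?thesis by simp
  qed
  have "(\<integral>\<^sup>+s\<in>{0<..<t}. \<rho> s \<partial>lborel) = (\<integral>\<^sup>+s. (SUP n. \<rho> s * indicator (A n) s) \<partial>lborel)"
    by (simp add: ind)
  also have "\<dots> = (SUP n. \<integral>\<^sup>+s. \<rho> s * indicator (A n) s \<partial>lborel)"
  proof (rule nn_integral_monotone_convergence_SUP)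
    show "incseq (\<lambda>n s. \<rho> s * indicator (A n) s)"
      using A_inc by (auto simp: incseq_def le_fun_def indicator_def)
  qed (simp add: A_def)
  also have "\<dots> \<le> ennreal (\<phi> t)"
    unfolding A_def using True
    by (intro SUP_least nn_integral_le_of_le_slope_shift mono nonneg slope meas)
       (auto simp: field_simps intro!: divide_pos_pos add_pos_nonneg)
  finally show ?thesis .
qed simp

lemma borel_measurable_antimono_ennreal:
  fixes \<rho> :: "real \<Rightarrow> ennreal"
  assumes "antimono \<rho>"
  shows "\<rho> \<in> borel_measurable borel"
proof (rule borel_measurableI_greater)
  fix y
  have "is_interval {x. y < \<rho> x}"
    unfolding is_interval_1 using antimonoD[OF assms] by (auto intro: less_le_trans)
  then have "{x. y < \<rho> x} \<in> sets borel"
    by (rule real_interval_borel_measurable)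
  then show "{x \<in> space borel. y < \<rho> x} \<in> sets borel" by simp
qed

section \<open>Neighbourhoods, level slices and restriction of desingularizing functions\<close>

lemma nbhd_eq_Union_ball: "nbhd \<epsilon> V = (\<Union>v\<in>V. ball v \<epsilon>)"
  by (auto simp: nbhd_def edist_set_def INF_less_iff ennreal_less_iff dist_commute)

lemma open_nbhd: "open (nbhd \<epsilon> V)"
  by (auto simp: nbhd_eq_Union_ball)

lemma subset_nbhd: "0 < \<epsilon> \<Longrightarrow> V \<subseteq> nbhd \<epsilon> V"
  by (auto simp: nbhd_eq_Union_ball)

lemma compact_nbhd_subset:
  assumes "compact V" "open U" "V \<subseteq> U"
  obtains \<epsilon> where "0 < \<epsilon>" "nbhd \<epsilon> V \<subseteq> U"
  using compact_subset_open_imp_ball_epsilon_subset[OF assms] by (auto simp: nbhd_eq_Union_ball)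

text \<open>Both inequalities of the slice are strict, so even for infinite \<open>\<eta>\<close>
  its points have finite values, and the level can be named by a real \<open>t\<close>.\<close>

lemma level_slice_iff:
  "x \<in> level_slice h V U \<eta> \<longleftrightarrow>
     x \<in> U \<and> (\<exists>t. h x = ereal (level_value h V + t) \<and> 0 < t \<and> ereal t < \<eta>)"
proof (cases "h x")
  case (real r)
  then show ?thesis
    by (auto simp: level_slice_def zero_ereal_def intro: exI[of _ "r - level_value h V"])
qed (auto simp: level_slice_def)

text \<open>This permits passing from the given open set and height to a metric neighbourhood and a
  finite height.\<close>

lemma concave_desingularizing_mono:
  assumes "concave_desingularizing h V U \<eta> \<phi>" and "U' \<subseteq> U" and "\<eta>' \<le> \<eta>"
  shows "concave_desingularizing h V U' \<eta>' \<phi>"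
proof -
  have sub: "hopen \<eta>' \<subseteq> hopen \<eta>" using assms(3) by (auto simp: hopen_def)
  have "is_interval (hopen \<eta>')"
    unfolding is_interval_1 hopen_def by (auto elim: le_less_trans[rotated])
  then have "convex (hopen \<eta>')" by (simp add: is_interval_convex)
  moreover have "level_slice h V U' \<eta>' \<subseteq> level_slice h V U \<eta>"
    using assms(2,3) by (auto simp: level_slice_def)
  ultimately show ?thesis
    using assms(1) sub unfolding concave_desingularizing_def Phi_def concave_on_def
    by (auto intro: convex_on_subset monotone_on_subset)
qed

text \<open>\<open>ennreal\<close> sends negative reals to 0, so the hypothesis forces
  \<open>D\<close> to be positive; an infinite \<open>d\<close> has inverse 0.\<close>

lemma ennreal_inverse_le_of_one_le_mult:
  fixes d :: ennreal
  assumes "1 \<le> ennreal D * d"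
  shows "inverse d \<le> ennreal D"
proof (cases d)
  case (real r)
  have "r \<noteq> 0" using assms real by auto
  with real have "0 < r" by simp
  have "0 \<le> D" using assms by (cases "0 \<le> D") (auto simp: ennreal_neg)
  with assms real have "1 \<le> D * r" by (simp flip: ennreal_mult ennreal_1)
  with \<open>0 < r\<close> have "inverse r \<le> D" by (simp add: field_simps)
  then show ?thesis using \<open>0 < r\<close> real by (simp add: inverse_ennreal ennreal_leI)
qed simp

section \<open>The density of the exact modulus\<close>

context
  fixes h :: "'a::real_inner \<Rightarrow> ereal" and V U :: "'a set" and \<eta> :: ereal and \<phi> :: "real \<Rightarrow> real"
  assumes desing: "concave_desingularizing h V U \<eta> \<phi>"
begin

lemma desingularizing_in_Phi: "\<phi> \<in> Phi \<eta>"
  using desing by (simp add: concave_desingularizing_def)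

lemma desingularizing_mono_on: "ereal t < \<eta> \<Longrightarrow> mono_on {0..t} \<phi>"
  using desingularizing_in_Phi
  by (intro mono_on_subset[OF strict_mono_on_imp_mono_on, of "hopen \<eta>"])
     (auto simp: Phi_def hopen_def elim: le_less_trans[rotated])

text \<open>At a point of level \<open>t\<close>, with \<open>s\<close> at most \<open>t\<close>,
  the KL inequality bounds the inverse distance by the left derivative at \<open>t\<close>.
  Concavity bounds this by the slope over the interval from \<open>s - \<delta>\<close> to
  \<open>t\<close>, and that by the slope up to \<open>s\<close>.\<close>

lemma modulus_density_le_slope:
  assumes "0 < \<delta>" "\<delta> < s"
  shows "modulus_density h V U \<eta> s \<le> ennreal ((\<phi> s - \<phi> (s - \<delta>)) / \<delta>)"
  unfolding modulus_density_def
proof (rule SUP_least)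
  fix x assume x: "x \<in> {x \<in> level_slice h V U \<eta>. ereal s \<le> h x - ereal (level_value h V)}"
  then obtain t where t: "h x = ereal (level_value h V + t)" "0 < t" "ereal t < \<eta>"
    by (auto simp: level_slice_iff)
  with x have "s \<le> t" by simp
  have sub: "{s - \<delta>..t} \<subseteq> hopen \<eta>"
    using assms t by (auto simp: hopen_def elim: le_less_trans[rotated])
  have conc: "concave_on (hopen \<eta>) \<phi>" using desing by (simp add: concave_desingularizing_def)
  let ?D = "vector_derivative \<phi> (at_left t)"
  have "?D \<le> (\<phi> t - \<phi> (s - \<delta>)) / (t - (s - \<delta>))"
    using assms \<open>s \<le> t\<close> t
    by (intro concave_left_derivative_le[OF conc sub] mono_on_subset[OF desingularizing_mono_on]) auto
  also have "\<dots> \<le> (\<phi> s - \<phi> (s - \<delta>)) / \<delta>"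
  proof (cases "s = t")
    case False
    have "(- \<phi> (s - \<delta>) - - \<phi> s) / (s - \<delta> - s) \<le> (- \<phi> (s - \<delta>) - - \<phi> t) / (s - \<delta> - t)"
      using assms sub \<open>s \<le> t\<close> False conc
      by (intro convex_on_slope_le(1)[where I = "hopen \<eta>"]) (auto simp: concave_on_def)
    moreover have "(- \<phi> (s - \<delta>) - - \<phi> u) / (s - \<delta> - u) = - ((\<phi> u - \<phi> (s - \<delta>)) / (u - (s - \<delta>)))" for u
      by (simp add: minus_divide_right)
    ultimately show ?thesis by simp
  qed simp
  finally have "?D \<le> (\<phi> s - \<phi> (s - \<delta>)) / \<delta>" .
  moreover have "1 \<le> ennreal ?D * edist_set 0 (limiting_subdiff h x)"
    using desing x t unfolding concave_desingularizing_def by auto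
  ultimately show "inverse (edist_set 0 (limiting_subdiff h x)) \<le> ennreal ((\<phi> s - \<phi> (s - \<delta>)) / \<delta>)"
    by (intro order_trans[OF ennreal_inverse_le_of_one_le_mult] ennreal_leI)
qed

lemma antimono_modulus_density: "antimono (modulus_density h V U \<eta>)"
  unfolding modulus_density_def
  by (intro antimonoI SUP_subset_mono) (auto elim: order_trans[rotated])

lemma borel_measurable_modulus_density [measurable]:
  "modulus_density h V U \<eta> \<in> borel_measurable borel"
  by (rule borel_measurable_antimono_ennreal[OF antimono_modulus_density])

text \<open>Besides comparing the modulus with \<open>\<phi>\<close>, this makes the integral
  finite, so that \<open>enn2real\<close> in \<open>exact_modulus\<close> loses nothing.\<close>

lemma nn_integral_modulus_density_le:
  assumes "ereal t < \<eta>"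
  shows "(\<integral>\<^sup>+s\<in>{0<..<t}. modulus_density h V U \<eta> s \<partial>lborel) \<le> ennreal (\<phi> t)"
  using desingularizing_in_Phi modulus_density_le_slope desingularizing_mono_on[OF assms]
  by (intro nn_integral_le_of_le_slope) (auto simp: Phi_def)

text \<open>The KL inequality excludes distance 0, so no subgradient at a point of the slice
  vanishes; the distance is at most the norm of any one of them.\<close>

lemma modulus_density_ge:
  assumes x: "x \<in> level_slice h V U \<eta>" and t: "h x = ereal (level_value h V + t)"
    and v: "v \<in> limiting_subdiff h x"
  shows "0 < norm v" and "ennreal (1 / norm v) \<le> modulus_density h V U \<eta> t"
proof -
  let ?e = "edist_set 0 (limiting_subdiff h x)"
  have le: "?e \<le> ennreal (norm v)"
    unfolding edist_set_def by (rule INF_lower2[OF v]) simp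
  have "1 \<le> ennreal (vector_derivative \<phi> (at_left t)) * ?e"
    using desing x t unfolding concave_desingularizing_def by auto
  then have "?e \<noteq> 0" by auto
  with le show pos: "0 < norm v"
    by (metis ennreal_0 le_zero_eq norm_ge_zero order_le_less)
  obtain r where r: "?e = ennreal r" "0 \<le> r"
    using le by (cases ?e) (auto simp: top_unique)
  with \<open>?e \<noteq> 0\<close> le have "0 < r" "r \<le> norm v" by auto
  then have "ennreal (1 / norm v) \<le> inverse ?e"
    using pos r by (auto simp: inverse_ennreal field_simps intro!: ennreal_leI)
  also have "\<dots> \<le> modulus_density h V U \<eta> t"
    unfolding modulus_density_def using x t by (intro SUP_upper) auto
  finally show "ennreal (1 / norm v) \<le> modulus_density h V U \<eta> t" .
qed

end

section \<open>The exact modulus as a desingularizing function\<close>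

context
  fixes h :: "'a::real_inner \<Rightarrow> ereal" and V :: "'a set" and \<epsilon> :: real and \<eta> :: ereal
    and \<phi> :: "real \<Rightarrow> real"
  assumes desing: "concave_desingularizing h V (nbhd \<epsilon> V) \<eta> \<phi>"
begin

lemma exact_modulus_nonneg: "0 \<le> exact_modulus h V \<epsilon> \<eta> t"
  by (simp add: exact_modulus_def)

lemma exact_modulus_le:
  assumes "0 \<le> t" "ereal t < \<eta>"
  shows "exact_modulus h V \<epsilon> \<eta> t \<le> \<phi> t"
  using enn2real_mono[OF nn_integral_modulus_density_le[OF desing assms(2)]]
    desingularizing_in_Phi[OF desing] assms
  by (auto simp: exact_modulus_def Phi_def hopen_def)

text \<open>The density is nonincreasing, so it is at least \<open>c\<close> on the whole interval
  from \<open>a\<close> to \<open>b\<close>. This replaces the tangent inequality for a concave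
  function in the length estimate.\<close>

lemma exact_modulus_diff_ge:
  assumes "0 \<le> a" "a \<le> b" "ereal b < \<eta>" "0 \<le> c"
    and c: "ennreal c \<le> modulus_density h V (nbhd \<epsilon> V) \<eta> b"
  shows "c * (b - a) \<le> exact_modulus h V \<epsilon> \<eta> b - exact_modulus h V \<epsilon> \<eta> a"
proof -
  note [measurable] = borel_measurable_modulus_density[OF desing]
  let ?\<rho> = "modulus_density h V (nbhd \<epsilon> V) \<eta>"
  let ?I = "\<lambda>t. \<integral>\<^sup>+s\<in>{0<..<t}. ?\<rho> s \<partial>lborel"
  have fin: "?I t < \<infinity>" if "ereal t < \<eta>" for t
    using nn_integral_modulus_density_le[OF desing that] by (simp add: order_le_less_trans)
  have "ereal a < \<eta>" using assms by (simp add: order_le_less_trans[of "ereal a" "ereal b"])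
  have "?I a + ennreal (c * (b - a)) = ?I a + (\<integral>\<^sup>+s. ennreal c * indicator {a<..<b} s \<partial>lborel)"
    using assms by (simp add: nn_integral_cmult ennreal_mult)
  also have "\<dots> = (\<integral>\<^sup>+s. ?\<rho> s * indicator {0<..<a} s + ennreal c * indicator {a<..<b} s \<partial>lborel)"
    by (rule nn_integral_add[symmetric]) auto
  also have "\<dots> \<le> ?I b"
  proof (rule nn_integral_mono)
    fix s
    have "ennreal c \<le> ?\<rho> s" if "s < b"
      using c antimonoD[OF antimono_modulus_density[OF desing], of s b] that by (auto intro: order_trans)
    then show "?\<rho> s * indicator {0<..<a} s + ennreal c * indicator {a<..<b} s
        \<le> ?\<rho> s * indicator {0<..<b} s"
      using assms by (auto simp: indicator_def)
  qed
  finally have "enn2real (?I a + ennreal (c * (b - a))) \<le> enn2real (?I b)"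
    using fin assms by (intro enn2real_mono) auto
  then show ?thesis
    using fin[OF \<open>ereal a < \<eta>\<close>] assms by (simp add: exact_modulus_def enn2real_plus)
qed

text \<open>Continuity at 0 comes from squeezing the modulus between 0 and \<open>\<phi>\<close>.
  Strict growth needs \<open>pos\<close>, since the density vanishes at levels above which the slice
  has no points.\<close>

lemma exact_modulus_in_Phi:
  assumes "\<eta> > 0"
    and pos: "\<And>s. 0 < s \<Longrightarrow> ereal s < \<eta> \<Longrightarrow> 0 < modulus_density h V (nbhd \<epsilon> V) \<eta> s"
  shows "exact_modulus h V \<epsilon> \<eta> \<in> Phi \<eta>"
proof -
  let ?m = "exact_modulus h V \<epsilon> \<eta>"
  have zero: "?m 0 = 0" by (simp add: exact_modulus_def)
  have "(?m \<longlongrightarrow> 0) (at_right 0)"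
  proof (rule tendsto_sandwich[where f = "\<lambda>_. 0" and h = \<phi>])
    obtain e where e: "0 < ereal e" "ereal e < \<eta>"
      using ereal_dense2[OF \<open>\<eta> > 0\<close>] by (metis)
    show "\<forall>\<^sub>F t in at_right 0. ?m t \<le> \<phi> t"
      unfolding eventually_at_right_field
    proof (intro exI[of _ e] conjI allI impI)
      fix t assume "0 < t" "t < e"
      moreover from \<open>t < e\<close> have "ereal t < \<eta>" using e(2) by (simp add: order_less_trans[of _ "ereal e"])
      ultimately show "?m t \<le> \<phi> t" by (intro exact_modulus_le) auto
    qed (use e in simp)
    show "(\<phi> \<longlongrightarrow> 0) (at_right 0)"
      using desingularizing_in_Phi[OF desing] by (auto simp: Phi_def continuous_within)
  qed (auto simp: exact_modulus_nonneg)
  then have "continuous (at_right 0) ?m" by (simp add: continuous_within zero)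
  moreover have "strict_mono_on (hopen \<eta>) ?m"
  proof (rule strict_mono_onI)
    fix a b assume ab: "a \<in> hopen \<eta>" "b \<in> hopen \<eta>" "a < b"
    then have b: "0 < modulus_density h V (nbhd \<epsilon> V) \<eta> b" by (intro pos) (auto simp: hopen_def)
    then obtain c where c: "0 < ennreal c" "ennreal c < modulus_density h V (nbhd \<epsilon> V) \<eta> b"
      using dense by (metis ennreal_cases infinity_ennreal_def less_top not_less_iff_gr_or_eq top.not_eq_extremum)
    then have "0 < c" by (simp add: ennreal_less_zero_iff)
    then have "0 < c * (b - a)" using ab by simp
    also have "\<dots> \<le> ?m b - ?m a"
      using ab c \<open>0 < c\<close> by (intro exact_modulus_diff_ge) (auto simp: hopen_def)
    finally show "?m a < ?m b" by simp
  qed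
  ultimately show ?thesis by (simp add: Phi_def zero exact_modulus_nonneg)
qed

end

section \<open>Subgradients and proximal points\<close>

lemma lsc_sequentially_le:
  assumes "lsc h" and "xs \<longlonglongrightarrow> x" and "(\<lambda>j. h (xs j)) \<longlonglongrightarrow> l"
  shows "h x \<le> l"
proof (rule ccontr)
  assume "\<not> h x \<le> l"
  then have "l < h x" by (rule not_le_imp_less)
  from dense[OF this] obtain c where c: "l < c" "c < h x" by (elim exE conjE)
  then have "c < Liminf (at x) h" using assms(1) less_le_trans[OF c(2)] by (simp add: lsc_def)
  then have "\<forall>\<^sub>F y in at x. c < h y" by (rule less_LiminfD)
  \<comment> \<open>The filter \<open>at x\<close> omits \<open>x\<close>, which the sequence may
    visit; \<open>c < h x\<close> puts it back.\<close>
  then have "\<forall>\<^sub>F y in nhds x. c < h y" using c(2) by (simp only: eventually_nhds_conv_at)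
  then have "\<forall>\<^sub>F j in sequentially. c < h (xs j)" 
    using assms(2) by (rule eventually_compose_filterlim)
  moreover have "\<forall>\<^sub>F j in sequentially. h (xs j) < c" using order_tendstoD(2)[OF assms(3) c(1)] .
  ultimately have "\<forall>\<^sub>F j in sequentially. False" by eventually_elim simp
  then show False by simp
qed

text \<open>A quadratic error is of smaller order than the norm. The subgradients of
  \<open>F\<close> and \<open>H\<close> below all arise from such global quadratic
  minorants.\<close>

lemma frechet_subdiffI_quadratic:
  assumes "h x < \<infinity>" and le: "\<And>y. h x + ereal (v \<bullet> (y - x) - C * (norm (y - x))\<^sup>2) \<le> h y"
  shows "v \<in> frechet_subdiff h x"
proof -
  let ?r = "\<lambda>y. - (C * (norm (y - x))\<^sup>2)"
  have "?r \<in> o[at x](\<lambda>y. norm (y - x))"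
  proof (rule smalloI_tendsto)
    have "((\<lambda>y. - (C * norm (y - x))) \<longlongrightarrow> - (C * norm (x - x))) (at x)"
      by (intro tendsto_intros)
    then have "((\<lambda>y. - (C * norm (y - x))) \<longlongrightarrow> 0) (at x)" by simp
    then show "((\<lambda>y. ?r y / norm (y - x)) \<longlongrightarrow> 0) (at x)"
      by (rule Lim_transform_eventually) (simp add: eventually_at_filter power2_eq_square)
  qed (simp add: eventually_at_filter)
  moreover have "\<forall>\<^sub>F y in at x. h x + ereal (v \<bullet> (y - x) + ?r y) \<le> h y"
    using le by (intro always_eventually) simp
  ultimately show ?thesis using assms(1) unfolding frechet_subdiff_def by blast
qed

lemma frechet_subdiff_subset_limiting: "frechet_subdiff h x \<subseteq> limiting_subdiff h x"
proof
  fix v assume v: "v \<in> frechet_subdiff h x"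
  then have "h x < \<infinity>" by (simp add: frechet_subdiff_def)
  with v show "v \<in> limiting_subdiff h x"
    unfolding limiting_subdiff_def mem_Collect_eq
    by (intro conjI exI[where x = "\<lambda>_. x"] exI[where x = "\<lambda>_. v"]) auto
qed

text \<open>The descent lemma: after subtracting the right-hand side along the segment, the
  derivative is nonpositive by Cauchy-Schwarz and the Lipschitz bound.\<close>

lemma lipschitz_gradient_le:
  fixes g :: "'a::real_inner \<Rightarrow> real"
  assumes grad: "\<And>u. GDERIV g u :> Dg u" and lip: "L-lipschitz_on UNIV Dg"
  shows "g v \<le> g u + Dg u \<bullet> (v - u) + L / 2 * (norm (v - u))\<^sup>2"
proof -
  define d where "d = v - u"
  define \<psi> where "\<psi> t = g (u + t *\<^sub>R d) - t * (Dg u \<bullet> d) - L / 2 * t\<^sup>2 * (norm d)\<^sup>2" for t :: real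
  have deriv: "(\<psi> has_real_derivative (Dg (u + t *\<^sub>R d) - Dg u) \<bullet> d - L * t * (norm d)\<^sup>2) (at t)" for t
  proof -
    have line: "((\<lambda>t. u + t *\<^sub>R d) has_derivative (\<lambda>h. h *\<^sub>R d)) (at t)"
      by (auto intro!: derivative_eq_intros)
    have "((\<lambda>t. g (u + t *\<^sub>R d)) has_derivative (\<lambda>h. (h *\<^sub>R d) \<bullet> Dg (u + t *\<^sub>R d))) (at t)"
      by (rule has_derivative_compose[OF line grad[unfolded gderiv_def]])
    then have "((\<lambda>t. g (u + t *\<^sub>R d)) has_real_derivative d \<bullet> Dg (u + t *\<^sub>R d)) (at t)"
      by (simp add: has_field_derivative_def mult_commute_abs)
    then show ?thesis
      unfolding \<psi>_def
      by (auto intro!: derivative_eq_intros simp: inner_diff inner_commute power2_eq_square)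
  qed
  have "\<psi> 1 \<le> \<psi> 0"
  proof (rule DERIV_nonpos_imp_nonincreasing[of 0 1])
    fix t :: real assume t: "0 \<le> t" "t \<le> 1"
    have "(Dg (u + t *\<^sub>R d) - Dg u) \<bullet> d \<le> norm (Dg (u + t *\<^sub>R d) - Dg u) * norm d"
      by (rule norm_cauchy_schwarz)
    also have "\<dots> \<le> (L * (t * norm d)) * norm d"
      using lipschitz_onD[OF lip, of "u + t *\<^sub>R d" u] t
      by (intro mult_right_mono) (auto simp: dist_norm)
    finally have "(Dg (u + t *\<^sub>R d) - Dg u) \<bullet> d - L * t * (norm d)\<^sup>2 \<le> 0"
      by (simp add: power2_eq_square)
    with deriv[of t] show "\<exists>y. (\<psi> has_real_derivative y) (at t) \<and> y \<le> 0" by blast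
  qed simp
  then show ?thesis by (simp add: \<psi>_def d_def)
qed

text \<open>The descent lemma for \<open>- g\<close>.\<close>

lemma lipschitz_gradient_ge:
  fixes g :: "'a::real_inner \<Rightarrow> real"
  assumes grad: "\<And>u. GDERIV g u :> Dg u" and lip: "L-lipschitz_on UNIV Dg"
  shows "g u + Dg u \<bullet> (v - u) - L / 2 * (norm (v - u))\<^sup>2 \<le> g v"
proof -
  have "L-lipschitz_on UNIV (\<lambda>u. - Dg u)" using lip by (simp add: lipschitz_on_minus)
  from lipschitz_gradient_le[OF GDERIV_minus[OF grad] this, of v u] show ?thesis by simp
qed

section \<open>Proximal points\<close>

lemma prox_le:
  "y \<in> prox lam f p \<Longrightarrow>
     f y + ereal (1 / (2 * lam) * (norm (p - y))\<^sup>2) \<le> f w + ereal (1 / (2 * lam) * (norm (p - w))\<^sup>2)"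
  by (auto simp: prox_def is_arg_min_def not_less)

lemma proper_prox_finite:
  assumes "proper f" "y \<in> prox lam f p"
  shows "\<bar>f y\<bar> \<noteq> \<infinity>"
proof -
  obtain w where "f w \<noteq> \<infinity>" using assms by (auto simp: proper_def)
  with prox_le[OF assms(2), of w] assms(1) show ?thesis
    by (cases "f y"; cases "f w") (auto simp: proper_def)
qed

text \<open>Expanding the square about \<open>y\<close> turns minimality into a quadratic minorant
  of \<open>f\<close> that touches \<open>f\<close> at \<open>y\<close>.\<close>

lemma prox_quadratic_le:
  assumes "y \<in> prox lam f p"
  shows "f y + ereal (((1 / lam) *\<^sub>R (p - y)) \<bullet> (w - y) - 1 / (2 * lam) * (norm (w - y))\<^sup>2) \<le> f w"
proof -
  have "(norm (p - w))\<^sup>2 = (norm (p - y))\<^sup>2 - 2 * ((p - y) \<bullet> (w - y)) + (norm (w - y))\<^sup>2"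
    unfolding power2_norm_eq_inner by (simp add: inner_diff inner_commute)
  moreover have "1 / lam = 2 * (1 / (2 * lam))" by simp
  ultimately have eq: "((1 / lam) *\<^sub>R (p - y)) \<bullet> (w - y) - 1 / (2 * lam) * (norm (w - y))\<^sup>2
      = 1 / (2 * lam) * (norm (p - y))\<^sup>2 - 1 / (2 * lam) * (norm (p - w))\<^sup>2"
    by (simp only: inner_scaleR_left) (simp only: ring_distribs mult.assoc)
  show ?thesis unfolding eq using prox_le[OF assms, of w] by (cases "f y"; cases "f w") auto
qed

text \<open>As an intersection of closures the set of cluster points is closed, which is used for
  its compactness.\<close>

lemma cluster_points_eq_INT_closure:
  fixes Z :: "nat \<Rightarrow> 'b::metric_space"
  shows "{w. \<exists>s. strict_mono s \<and> (\<lambda>j. Z (s j)) \<longlonglongrightarrow> w} = (\<Inter>N. closure (Z ` {N..}))"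
proof (intro equalityI subsetI INT_I)
  fix w N assume "w \<in> {w. \<exists>s. strict_mono s \<and> (\<lambda>j. Z (s j)) \<longlonglongrightarrow> w}"
  then obtain s where s: "strict_mono s" "(\<lambda>j. Z (s j)) \<longlonglongrightarrow> w"
    unfolding mem_Collect_eq by (elim exE conjE)
  have "N \<le> s (j + N)" for j using seq_suble[OF s(1), of "j + N"] by linarith
  then show "w \<in> closure (Z ` {N..})"
    using LIMSEQ_ignore_initial_segment[OF s(2), of N]
    unfolding closure_sequential by (intro exI[of _ "\<lambda>j. Z (s (j + N))"] conjI allI) simp_all
next
  fix w assume w: "w \<in> (\<Inter>N. closure (Z ` {N..}))"
  have ex: "\<exists>k. dist (Z k) w < inverse (real (Suc n)) \<and> N < k" for N n
  proof -
    have "w \<in> closure (Z ` {Suc N..})" using w by blast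
    moreover have "0 < inverse (real (Suc n))" by simp
    ultimately obtain k where "k \<ge> Suc N" "dist (Z k) w < inverse (real (Suc n))"
      unfolding closure_approachable by blast
    then show ?thesis by (intro exI[of _ k]) simp
  qed
  have "\<exists>s. \<forall>n. dist (Z (s n)) w < inverse (real (Suc n)) \<and> s n < s (Suc n)"
  proof (rule dependent_nat_choice)
    show "\<exists>k. dist (Z k) w < inverse (real (Suc 0))" using ex[of 0 0] by (elim exE conjE) (rule exI)
    show "\<exists>k. dist (Z k) w < inverse (real (Suc (Suc n))) \<and> m < k" for m n by (rule ex)
  qed
  then obtain s where "\<forall>n. dist (Z (s n)) w < inverse (real (Suc n)) \<and> s n < s (Suc n)"
    by (elim exE)
  note s = this[THEN spec, THEN conjunct1] this[THEN spec, THEN conjunct2]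
  have "(\<lambda>j. dist (Z (s j)) w) \<longlonglongrightarrow> 0"
  proof (rule tendsto_sandwich[OF _ _ tendsto_const LIMSEQ_inverse_real_of_nat])
    show "\<forall>\<^sub>F j in sequentially. dist (Z (s j)) w \<le> inverse (real (Suc j))"
      using less_imp_le[OF s(1)] by (intro always_eventually allI)
  qed simp
  then have "(\<lambda>j. Z (s j)) \<longlonglongrightarrow> w" by (rule tendsto_dist_iff[THEN iffD2])
  moreover have "strict_mono s" using s(2) by (simp add: strict_mono_Suc_iff)
  ultimately show "w \<in> {w. \<exists>s. strict_mono s \<and> (\<lambda>j. Z (s j)) \<longlonglongrightarrow> w}"
    unfolding mem_Collect_eq by (intro exI[of _ s] conjI)
qed

text \<open>One of the two copies of \<open>a (Suc n)\<close> telescopes against \<open>a n\<close>.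
  The induction keeps the leftover terms at \<open>i + m\<close>, which are dropped at the end by
  nonnegativity.\<close>

lemma sum_le_of_two_mult_le:
  fixes a b :: "nat \<Rightarrow> real"
  assumes step: "\<And>n. N \<le> n \<Longrightarrow> 2 * a (Suc n) \<le> a n + (b n - b (Suc n))"
    and "N \<le> i" "\<And>n. 0 \<le> a n" "\<And>n. 0 \<le> b n"
  shows "(\<Sum>j<m. a (Suc (i + j))) \<le> a i + b i"
proof -
  have "(\<Sum>j<m. a (Suc (i + j))) + a (i + m) + b (i + m) \<le> a i + b i"
  proof (induction m)
    case (Suc m)
    from Suc step[of "i + m"] \<open>N \<le> i\<close> show ?case by simp
  qed simp
  with assms(3)[of "i + m"] assms(4)[of "i + m"] show ?thesis by linarith
qed

lemma two_mult_le_add_of_sq_le: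
  fixes a b c :: real
  assumes "a\<^sup>2 \<le> b * c" "0 \<le> b" "0 \<le> c"
  shows "2 * a \<le> b + c"
proof (rule power2_le_imp_le)
  have "(2 * a)\<^sup>2 \<le> 4 * (b * c)" using assms by (simp add: power_mult_distrib)
  also have "\<dots> \<le> (b + c)\<^sup>2" using sum_squares_bound[of b c] by (simp add: power2_sum)
  finally show "(2 * a)\<^sup>2 \<le> (b + c)\<^sup>2" .
qed (use assms in simp)

section \<open>The forward-reflected-backward iteration\<close>

text \<open>In \<open>step\<close> the point \<open>y\<^sub>k\<close> is written out and merged with
  the forward term; \<open>step_size\<close> is the bound \<open>1 / (4 * L)\<close> on
  \<open>lam\<close> without division.\<close>

locale frb_iteration =
  fixes f :: "'a::euclidean_space \<Rightarrow> ereal" and g :: "'a \<Rightarrow> real" and Dg :: "'a \<Rightarrow> 'a"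
    and L lam :: real and X :: "nat \<Rightarrow> 'a"
  assumes proper: "proper f" and lsc: "lsc f"
    and gradient: "\<And>u. GDERIV g u :> Dg u" and lipschitz: "L-lipschitz_on UNIV Dg"
    and lam_pos: "0 < lam" and L_pos: "0 < L" and step_size: "4 * lam * L < 1"
    and bounded_below: "\<exists>m. \<forall>u. ereal m \<le> f u + ereal (g u)"
    and bounded_range: "bounded (range (\<lambda>n. (X (Suc n), X n)))"
    and step: "\<And>n. X (Suc (Suc n)) \<in>
      prox lam f (X (Suc n) + lam *\<^sub>R (Dg (X n) - 2 *\<^sub>R Dg (X (Suc n))))"
begin

text \<open>The paper's \<open>x\<^sub>k\<close> is \<open>X (k + 1)\<close>, so its \<open>z\<^sub>k\<close> is \<open>pair (k + 1)\<close>; the sequences \<open>fval\<close>, \<open>merit\<close>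
  and \<open>prox_subgrad\<close> are indexed so that \<open>n\<close> belongs to \<open>z\<^sub>n = pair (n + 1)\<close>, where \<open>f\<close> is finite for every \<open>n \<ge> 0\<close>.\<close>

definition "pair n = (X (Suc n), X n)"
definition "gap n = norm (pair (Suc n) - pair n)"
definition "fval n = real_of_ereal (f (X (Suc (Suc n))))"
definition "merit n = fval n + g (X (Suc (Suc n)))
  + 1 / (4 * lam) * (norm (X (Suc (Suc n)) - X (Suc n)))\<^sup>2"
definition "prox_subgrad n = Dg (X n) - 2 *\<^sub>R Dg (X (Suc n))
  - (1 / lam) *\<^sub>R (X (Suc (Suc n)) - X (Suc n))"
definition "clusters = {w. \<exists>s. strict_mono s \<and> (\<lambda>j. pair (s j)) \<longlonglongrightarrow> w}"
definition "limit_value = lim merit"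

abbreviation "F \<equiv> \<lambda>u. f u + ereal (g u)"
abbreviation "H \<equiv> frb_merit f g lam"

lemma f_eq_fval: "f (X (Suc (Suc n))) = ereal (fval n)"
  using proper_prox_finite[OF proper step] by (simp add: fval_def ereal_real')

text \<open>\<open>prox_subgrad n\<close> is the difference of the prox argument and the prox point
  divided by \<open>lam\<close>. The descent of the merit and the subgradients of \<open>H\<close>
  both rest on this inequality.\<close>

lemma prox_subgrad_le:
  "ereal (fval n + prox_subgrad n \<bullet> (w - X (Suc (Suc n))) - 1 / (2 * lam) * (norm (w - X (Suc (Suc n))))\<^sup>2)
     \<le> f w"
proof -
  have "(1 / lam) *\<^sub>R (X (Suc n) + lam *\<^sub>R (Dg (X n) - 2 *\<^sub>R Dg (X (Suc n))) - X (Suc (Suc n))) = prox_subgrad n"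
    using lam_pos by (simp add: prox_subgrad_def scaleR_diff_right scaleR_add_right)
  with prox_quadratic_le[OF step, of n w] show ?thesis
    by (simp add: f_eq_fval add_diff_eq)
qed

lemma merit_pair: "H (pair (Suc n)) = ereal (merit n)"
  by (simp add: frb_merit_def pair_def f_eq_fval merit_def)

lemma gap_sq: "(gap n)\<^sup>2 = (norm (X (Suc (Suc n)) - X (Suc n)))\<^sup>2 + (norm (X (Suc n) - X n))\<^sup>2"
  by (simp add: gap_def pair_def norm_Pair)

lemma gap_nonneg: "0 \<le> gap n"
  by (simp add: gap_def)

lemma norm_diff_le_gap:
  "norm (X (Suc (Suc n)) - X (Suc n)) \<le> gap n" "norm (X (Suc n) - X n) \<le> gap n"
  using norm_fst_le[of "X (Suc (Suc n)) - X (Suc n)" "X (Suc n) - X n"]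
    norm_snd_le[of "X (Suc n) - X n" "X (Suc (Suc n)) - X (Suc n)"]
  by (simp_all add: gap_def pair_def)

section \<open>Descent of the merit function and its subgradients\<close>

lemma norm_grad_diff_le: "norm (Dg u - Dg v) \<le> L * norm (u - v)"
  using lipschitz_onD[OF lipschitz, of u v] by (simp add: dist_norm)

lemma merit_descent: "merit (Suc n) + (1 / (4 * lam) - L) * (gap (Suc n))\<^sup>2 \<le> merit n"
proof -
  let ?y = "X (Suc (Suc n))" and ?z = "X (Suc n)"
  define d where "d = X (Suc (Suc (Suc n))) - ?y"
  define e where "e = ?y - ?z"
  \<comment> \<open>The proximal inequality is tested at the previous iterate.\<close>
  have "fval (Suc n) + prox_subgrad (Suc n) \<bullet> (- d) - 1 / (2 * lam) * (norm d)\<^sup>2 \<le> fval n"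
    using prox_subgrad_le[of "Suc n" ?y] by (simp add: f_eq_fval d_def norm_minus_commute)
  moreover have "prox_subgrad (Suc n) \<bullet> (- d)
      = Dg ?y \<bullet> d - (Dg ?z - Dg ?y) \<bullet> d + 2 * (1 / (2 * lam) * (norm d)\<^sup>2)"
    by (simp add: prox_subgrad_def d_def[symmetric] inner_diff_left power2_norm_eq_inner)
  moreover have "g (X (Suc (Suc (Suc n)))) \<le> g ?y + Dg ?y \<bullet> d + L / 2 * (norm d)\<^sup>2"
    using lipschitz_gradient_le[OF gradient lipschitz] by (simp add: d_def)
  moreover have "(Dg ?z - Dg ?y) \<bullet> d \<le> L / 2 * (norm d)\<^sup>2 + L / 2 * (norm e)\<^sup>2"
  proof -
    have "(Dg ?z - Dg ?y) \<bullet> d \<le> norm (Dg ?z - Dg ?y) * norm d" by (rule norm_cauchy_schwarz)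
    also have "\<dots> \<le> (L * norm e) * norm d"
      using norm_grad_diff_le[of ?z ?y] by (intro mult_right_mono) (auto simp: e_def norm_minus_commute)
    also have "\<dots> = L * (norm d * norm e)" by simp
    also have "\<dots> \<le> L * (((norm d)\<^sup>2 + (norm e)\<^sup>2) / 2)"
      using sum_squares_bound[of "norm d" "norm e"] L_pos by (intro mult_left_mono) auto
    finally show ?thesis by (simp add: field_simps)
  qed
  \<comment> \<open>The estimates yield the factor \<open>1 / (4 * lam) - L / 2\<close> for
    \<open>e\<close>; giving up this term makes it equal to the factor for \<open>d\<close>, so that
    both squares combine to that of the gap.\<close>
  moreover have "0 \<le> L / 2 * (norm e)\<^sup>2" using L_pos by simp
  moreover have "merit (Suc n) = fval (Suc n) + g (X (Suc (Suc (Suc n)))) + 1 / (4 * lam) * (norm d)\<^sup>2"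
    "merit n = fval n + g ?y + 1 / (4 * lam) * (norm e)\<^sup>2"
    by (simp_all add: merit_def d_def e_def)
  moreover have "(1 / (4 * lam) - L) * (gap (Suc n))\<^sup>2
      = 1 / (4 * lam) * (norm d)\<^sup>2 - L * (norm d)\<^sup>2 + (1 / (4 * lam) * (norm e)\<^sup>2 - L * (norm e)\<^sup>2)"
  proof -
    have "(c - L) * (A + B) = c * A - L * A + (c * B - L * B)" for c A B :: real
      by (simp add: algebra_simps)
    then show ?thesis unfolding gap_sq d_def[symmetric] e_def[symmetric] .
  qed
  moreover have "1 / (2 * lam) * (norm d)\<^sup>2 = 2 * (1 / (4 * lam) * (norm d)\<^sup>2)" by simp
  ultimately show ?thesis by linarith
qed

lemma quarter_step_gt: "0 < 1 / (4 * lam) - L"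
  using step_size lam_pos by (simp add: field_simps)

text \<open>Since \<open>f w\<close> may be infinite, estimates are reduced to real ones with the
  minorant in place of \<open>f w\<close>.\<close>

lemma ereal_le_f_add:
  assumes "a \<le> fval n + prox_subgrad n \<bullet> (w - X (Suc (Suc n)))
    - 1 / (2 * lam) * (norm (w - X (Suc (Suc n))))\<^sup>2 + c"
  shows "ereal a \<le> f w + ereal c"
proof -
  have "ereal a \<le> ereal (fval n + prox_subgrad n \<bullet> (w - X (Suc (Suc n)))
    - 1 / (2 * lam) * (norm (w - X (Suc (Suc n))))\<^sup>2) + ereal c"
    using assms by simp
  also have "\<dots> \<le> f w + ereal c" by (intro add_right_mono prox_subgrad_le)
  finally show ?thesis .
qed

lemma subgrad_F: "prox_subgrad n + Dg (X (Suc (Suc n))) \<in> frechet_subdiff F (X (Suc (Suc n)))"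
proof (rule frechet_subdiffI_quadratic[where C = "1 / (2 * lam) + L / 2"])
  fix w
  let ?y = "X (Suc (Suc n))"
  have "fval n + g ?y + ((prox_subgrad n + Dg ?y) \<bullet> (w - ?y) - (1 / (2 * lam) + L / 2) * (norm (w - ?y))\<^sup>2)
      \<le> (fval n + prox_subgrad n \<bullet> (w - ?y) - 1 / (2 * lam) * (norm (w - ?y))\<^sup>2) + g w"
    using lipschitz_gradient_ge[OF gradient lipschitz, of ?y w]
    by (simp only: inner_add_left ring_distribs)
  then show "F ?y + ereal ((prox_subgrad n + Dg ?y) \<bullet> (w - ?y) - (1 / (2 * lam) + L / 2) * (norm (w - ?y))\<^sup>2)
      \<le> F w"
    unfolding f_eq_fval plus_ereal.simps by (rule ereal_le_f_add)
qed (simp add: f_eq_fval)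

lemma H_eq: "H (u, v) = f u + ereal (g u + 1 / (4 * lam) * (norm (u - v))\<^sup>2)"
  by (simp add: frb_merit_def add.assoc)

text \<open>The coupling term is convex in the pair, so its linearization is a minorant that can be
  added to those of \<open>f\<close> and \<open>g\<close>. The second component \<open>v\<close> is
  left free because the positivity of the modulus density needs points off the sequence.\<close>

lemma subgrad_H:
  "(prox_subgrad n + Dg (X (Suc (Suc n))) + (1 / (2 * lam)) *\<^sub>R (X (Suc (Suc n)) - v),
    (1 / (2 * lam)) *\<^sub>R (v - X (Suc (Suc n)))) \<in> frechet_subdiff H (X (Suc (Suc n)), v)"
    (is "(?A, ?B) \<in> _")
proof (rule frechet_subdiffI_quadratic[where C = "1 / (2 * lam) + L / 2"])
  fix z :: "'a \<times> 'a"
  obtain w v' where z: "z = (w, v')" by (cases z)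
  let ?y = "X (Suc (Suc n))"
  define D E T c where "D = w - ?y" and "E = v' - v" and "T = ?y - v" and "c = 1 / (4 * lam)"
  have c: "0 < c" "1 / (2 * lam) = 2 * c" using lam_pos by (simp_all add: c_def)
  have "w - v' = T + (D - E)" by (simp add: D_def E_def T_def)
  then have "(norm (w - v'))\<^sup>2 = (norm T)\<^sup>2 + 2 * (T \<bullet> D) - 2 * (T \<bullet> E) + (norm (D - E))\<^sup>2"
    unfolding power2_norm_eq_inner by (simp only: inner_add inner_diff inner_commute)
  \<comment> \<open>Convexity of the coupling term: the square of \<open>D - E\<close> is
    dropped.\<close>
  then have "(norm T)\<^sup>2 + 2 * (T \<bullet> D) - 2 * (T \<bullet> E) \<le> (norm (w - v'))\<^sup>2" by simp
  then have "c * ((norm T)\<^sup>2 + 2 * (T \<bullet> D) - 2 * (T \<bullet> E)) \<le> c * (norm (w - v'))\<^sup>2"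
    using c by (intro mult_left_mono) auto
  then have 1: "c * (norm T)\<^sup>2 + 2 * c * (T \<bullet> D) - 2 * c * (T \<bullet> E) \<le> c * (norm (w - v'))\<^sup>2"
    by (simp add: algebra_simps)
  have 2: "?A \<bullet> D = prox_subgrad n \<bullet> D + Dg ?y \<bullet> D + 2 * c * (T \<bullet> D)" "?B \<bullet> E = - (2 * c * (T \<bullet> E))"
    unfolding c(2) by (simp_all add: inner_add_left T_def inner_diff_left algebra_simps)
  \<comment> \<open>The error involves only \<open>D\<close>; adding a multiple of the square of
    \<open>E\<close> makes it quadratic in the norm of the pair.\<close>
  have "0 \<le> (2 * c + L / 2) * (norm E)\<^sup>2" using c L_pos by simp
  then have 3: "2 * c * (norm D)\<^sup>2 + L / 2 * (norm D)\<^sup>2 \<le> (2 * c + L / 2) * ((norm D)\<^sup>2 + (norm E)\<^sup>2)"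
    by (simp only: ring_distribs)
  have "g ?y + Dg ?y \<bullet> D - L / 2 * (norm D)\<^sup>2 \<le> g w"
    using lipschitz_gradient_ge[OF gradient lipschitz, of ?y w] by (simp add: D_def)
  with 1 2 3 have "fval n + (g ?y + c * (norm T)\<^sup>2) + (?A \<bullet> D + ?B \<bullet> E - (2 * c + L / 2) * ((norm D)\<^sup>2 + (norm E)\<^sup>2))
      \<le> fval n + prox_subgrad n \<bullet> D - 2 * c * (norm D)\<^sup>2 + (g w + c * (norm (w - v'))\<^sup>2)"
    by linarith
  then have "ereal (fval n + (g ?y + c * (norm T)\<^sup>2) + (?A \<bullet> D + ?B \<bullet> E - (2 * c + L / 2) * ((norm D)\<^sup>2 + (norm E)\<^sup>2)))
      \<le> f w + ereal (g w + c * (norm (w - v'))\<^sup>2)"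
    by (intro ereal_le_f_add) (simp only: c(2) D_def)
  then show "H (?y, v) + ereal ((?A, ?B) \<bullet> (z - (?y, v)) - (1 / (2 * lam) + L / 2) * (norm (z - (?y, v)))\<^sup>2)
      \<le> H z"
    unfolding H_eq z f_eq_fval diff_Pair inner_Pair norm_Pair D_def[symmetric] E_def[symmetric]
      T_def[symmetric] c_def[symmetric]
    by (simp add: c(2))
qed (simp add: H_eq f_eq_fval)

lemma ex_subgrad_H_le:
  "\<exists>v \<in> limiting_subdiff H (pair (Suc n)). norm v \<le> (1 / lam + 2 * L) * gap n"
proof -
  let ?y = "X (Suc (Suc n))" and ?z = "X (Suc n)"
  define A where "A = prox_subgrad n + Dg ?y + (1 / (2 * lam)) *\<^sub>R (?y - ?z)"
  define B where "B = (1 / (2 * lam)) *\<^sub>R (?z - ?y)"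
  have "(A, B) \<in> limiting_subdiff H (pair (Suc n))"
    unfolding A_def B_def pair_def using subgrad_H frechet_subdiff_subset_limiting by blast
  moreover have "norm (A, B) \<le> (1 / lam + 2 * L) * gap n"
  proof -
    define R where "R = (1 / (2 * lam)) *\<^sub>R (?y - ?z)"
    have "(1 / lam) *\<^sub>R (?y - ?z) = R + R"
      unfolding R_def scaleR_add_left[symmetric] by simp
    \<comment> \<open>The coupling gradient cancels half of the \<open>1 / lam\<close> term. The
      other half \<open>R\<close> and the second component \<open>B\<close> then contribute
      \<open>1 / (2 * lam)\<close> each, and the two gradient differences contribute
      \<open>L\<close> each.\<close>
    then have "A = (Dg (X n) - Dg ?z) + (Dg ?y - Dg ?z) - R"
      unfolding A_def prox_subgrad_def R_def[symmetric] scaleR_2 by simp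
    then have "norm A \<le> norm (Dg (X n) - Dg ?z) + norm (Dg ?y - Dg ?z) + norm R"
      by (simp only:) (rule order_trans[OF norm_triangle_ineq4 add_right_mono[OF norm_triangle_ineq]])
    moreover have "norm (Dg (X n) - Dg ?z) \<le> L * gap n"
      using order_trans[OF norm_grad_diff_le mult_left_mono[OF norm_diff_le_gap(2)]] L_pos
      by (simp add: norm_minus_commute)
    moreover have "norm (Dg ?y - Dg ?z) \<le> L * gap n"
      using order_trans[OF norm_grad_diff_le mult_left_mono[OF norm_diff_le_gap(1)]] L_pos
      by simp
    moreover have half: "norm R \<le> 1 / (2 * lam) * gap n"
      unfolding R_def norm_scaleR using norm_diff_le_gap(1)[of n] lam_pos by (intro mult_mono) auto
    moreover have "norm B \<le> 1 / (2 * lam) * gap n"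
      using half unfolding B_def R_def norm_scaleR by (simp only: norm_minus_commute)
    moreover have "norm (A, B) \<le> norm A + norm B" by (rule norm_Pair_le)
    moreover have "(1 / lam + 2 * L) * gap n = L * gap n + L * gap n + 1 / (2 * lam) * gap n + 1 / (2 * lam) * gap n"
      by (simp add: algebra_simps)
    ultimately show ?thesis by linarith
  qed
  ultimately show ?thesis by blast
qed

lemma merit_Suc_le: "merit (Suc n) \<le> merit n"
proof -
  have "0 \<le> (1 / (4 * lam) - L) * (gap (Suc n))\<^sup>2"
    using quarter_step_gt by (intro mult_nonneg_nonneg) auto
  with merit_descent[of n] show ?thesis by linarith
qed

lemma merit_tendsto: "merit \<longlonglongrightarrow> limit_value"
proof -
  obtain m where m: "\<And>u. ereal m \<le> F u" using bounded_below by blast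
  have "m \<le> merit n" for n
  proof -
    have "m \<le> fval n + g (X (Suc (Suc n)))" using m[of "X (Suc (Suc n))"] by (simp add: f_eq_fval)
    moreover have "0 \<le> 1 / (4 * lam) * (norm (X (Suc (Suc n)) - X (Suc n)))\<^sup>2" using lam_pos by simp
    ultimately show ?thesis unfolding merit_def by linarith
  qed
  moreover have "decseq merit" by (rule decseq_SucI) (rule merit_Suc_le)
  ultimately obtain l where "merit \<longlonglongrightarrow> l" using decseq_convergent by blast
  then show ?thesis unfolding limit_value_def using limI by blast
qed

lemma limit_value_le_merit: "limit_value \<le> merit n"
proof (rule decseq_ge[OF _ merit_tendsto])
  show "decseq merit" by (rule decseq_SucI) (rule merit_Suc_le)
qed

lemma gap_tendsto_0: "gap \<longlonglongrightarrow> 0"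
proof -
  let ?c = "1 / (4 * lam) - L"
  have "(\<lambda>n. (merit n - merit (Suc n)) / ?c) \<longlonglongrightarrow> (limit_value - limit_value) / ?c"
    using quarter_step_gt by (intro tendsto_intros merit_tendsto LIMSEQ_Suc) auto
  then have lim: "(\<lambda>n. (merit n - merit (Suc n)) / ?c) \<longlonglongrightarrow> 0" by simp
  have "(\<lambda>n. (gap (Suc n))\<^sup>2) \<longlonglongrightarrow> 0"
  proof (rule tendsto_sandwich[OF _ _ tendsto_const lim])
    show "\<forall>\<^sub>F n in sequentially. (gap (Suc n))\<^sup>2 \<le> (merit n - merit (Suc n)) / ?c"
      using merit_descent quarter_step_gt
      by (intro always_eventually allI) (simp add: pos_le_divide_eq mult.commute le_diff_eq add.commute)
  qed simp
  from tendsto_real_sqrt[OF this] have "(\<lambda>n. gap (Suc n)) \<longlonglongrightarrow> 0"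
    by (simp add: gap_nonneg)
  then show ?thesis by (rule LIMSEQ_imp_Suc)
qed

section \<open>Cluster points of the pairs\<close>

lemma bounded_range_pair: "bounded (range pair)"
  using bounded_range by (simp add: pair_def[abs_def])

lemma compact_clusters: "compact clusters"
proof -
  have eq: "clusters = (\<Inter>N. closure (pair ` {N..}))"
    unfolding clusters_def by (rule cluster_points_eq_INT_closure)
  have "closed clusters" unfolding eq by (intro closed_INT ballI closed_closure)
  moreover have "clusters \<subseteq> closure (pair ` {0..})" unfolding eq by (rule INT_lower) simp
  then have "bounded clusters"
    by (rule bounded_subset[rotated]) (intro bounded_closure bounded_subset[OF bounded_range_pair] image_mono subset_UNIV)
  ultimately show ?thesis by (simp add: compact_eq_bounded_closed)
qed

lemma subsequence_meets_clusters:
  fixes s :: "nat \<Rightarrow> nat"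
  assumes "strict_mono s"
  obtains w r where "w \<in> clusters" "strict_mono r" "(\<lambda>j. pair (s (r j))) \<longlonglongrightarrow> w"
proof -
  have "bounded (range (\<lambda>j. pair (s j)))"
    by (rule bounded_subset[OF bounded_range_pair]) (simp add: image_subset_iff)
  from bounded_imp_convergent_subsequence[OF this]
  obtain w r where r: "strict_mono r" "((\<lambda>j. pair (s j)) \<circ> r) \<longlonglongrightarrow> w"
    by (elim exE conjE)
  have "w \<in> clusters"
    unfolding clusters_def mem_Collect_eq
    using r strict_mono_o[OF assms r(1)] by (intro exI[of _ "s \<circ> r"]) (simp add: o_def)
  then show thesis using r that by (simp add: o_def)
qed

lemma clusters_nonempty: "clusters \<noteq> {}"
  by (rule subsequence_meets_clusters[OF strict_mono_id]) (rule notI, simp)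

text \<open>A subsequence outside \<open>U\<close> would, by boundedness, accumulate at a cluster
  point, and the open set \<open>U\<close> contains all of these.\<close>

lemma eventually_pair_mem:
  assumes "open U" "clusters \<subseteq> U"
  shows "\<forall>\<^sub>F n in sequentially. pair n \<in> U"
proof (rule ccontr)
  assume "\<not> (\<forall>\<^sub>F n in sequentially. pair n \<in> U)"
  from not_eventually_sequentiallyD[OF this]
  obtain s :: "nat \<Rightarrow> nat" where s: "strict_mono s" "\<forall>n. pair (s n) \<notin> U"
    by (elim exE conjE)
  obtain w r where w: "w \<in> clusters" "(\<lambda>j. pair (s (r j))) \<longlonglongrightarrow> w"
    using subsequence_meets_clusters[OF s(1)] by blast
  then have "\<forall>\<^sub>F j in sequentially. pair (s (r j)) \<in> U"
    using assms by (intro topological_tendstoD[OF w(2)]) auto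
  then show False using s(2) by simp
qed

lemma isCont_Dg: "isCont Dg u"
  using lipschitz_on_continuous_on[OF lipschitz] by (simp add: continuous_on_eq_continuous_at)

lemma isCont_g: "isCont g u"
  using gradient[of u] has_derivative_continuous by (auto simp: gderiv_def)

text \<open>Vanishing gaps bring three consecutive iterates to the same limit. The index map only
  has to tend to infinity, so that both subsequences and the full sequence are covered.\<close>

lemma accumulation:
  assumes t: "filterlim t at_top sequentially" and lim: "(\<lambda>j. pair (Suc (t j))) \<longlonglongrightarrow> (u, v)"
  shows "v = u" and "f u = ereal (limit_value - g u)" and "(\<lambda>j. prox_subgrad (t j)) \<longlonglongrightarrow> - Dg u"
    and "(\<lambda>j. fval (t j)) \<longlonglongrightarrow> limit_value - g u"
proof -
  have y: "(\<lambda>j. X (Suc (Suc (t j)))) \<longlonglongrightarrow> u" and z: "(\<lambda>j. X (Suc (t j))) \<longlonglongrightarrow> v"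
    using tendsto_fst[OF lim] tendsto_snd[OF lim] by (simp_all add: pair_def)
  have gap: "(\<lambda>j. gap (t j)) \<longlonglongrightarrow> 0"
    by (rule filterlim_compose[OF gap_tendsto_0 t])
  have d: "(\<lambda>j. X (Suc (Suc (t j))) - X (Suc (t j))) \<longlonglongrightarrow> 0"
    by (rule Lim_null_comparison[OF _ gap]) (simp add: norm_diff_le_gap)
  have e: "(\<lambda>j. X (Suc (t j)) - X (t j)) \<longlonglongrightarrow> 0"
    by (rule Lim_null_comparison[OF _ gap]) (simp add: norm_diff_le_gap)
  from LIMSEQ_unique[OF d tendsto_diff[OF y z]] show "v = u" by simp
  with z have z: "(\<lambda>j. X (Suc (t j))) \<longlonglongrightarrow> u" by simp
  from tendsto_diff[OF z e] have x: "(\<lambda>j. X (t j)) \<longlonglongrightarrow> u" by simp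
  have "(\<lambda>j. prox_subgrad (t j)) \<longlonglongrightarrow> Dg u - 2 *\<^sub>R Dg u - (1 / lam) *\<^sub>R 0"
    unfolding prox_subgrad_def
    by (intro tendsto_intros isCont_tendsto_compose[OF isCont_Dg] x z d)
  then show sub: "(\<lambda>j. prox_subgrad (t j)) \<longlonglongrightarrow> - Dg u" by (simp add: scaleR_2)
  have "(\<lambda>j. merit (t j) - g (X (Suc (Suc (t j))))
      - 1 / (4 * lam) * (norm (X (Suc (Suc (t j))) - X (Suc (t j))))\<^sup>2)
      \<longlonglongrightarrow> limit_value - g u - 1 / (4 * lam) * (norm (0::'a))\<^sup>2"
    by (intro tendsto_intros filterlim_compose[OF merit_tendsto t] isCont_tendsto_compose[OF isCont_g] y d)
  then show fv: "(\<lambda>j. fval (t j)) \<longlonglongrightarrow> limit_value - g u" by (simp add: merit_def)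
  then have "(\<lambda>j. f (X (Suc (Suc (t j))))) \<longlonglongrightarrow> ereal (limit_value - g u)"
    unfolding f_eq_fval by (rule tendsto_ereal)
  from lsc_sequentially_le[OF lsc y this] have le: "f u \<le> ereal (limit_value - g u)" .
  \<comment> \<open>Lower semicontinuity gives one inequality; the other follows by evaluating the
    proximal minorants at \<open>u\<close> and passing to the limit.\<close>
  have "(\<lambda>j. ereal (fval (t j) + prox_subgrad (t j) \<bullet> (u - X (Suc (Suc (t j))))
      - 1 / (2 * lam) * (norm (u - X (Suc (Suc (t j)))))\<^sup>2))
      \<longlonglongrightarrow> ereal (limit_value - g u + (- Dg u) \<bullet> (u - u) - 1 / (2 * lam) * (norm (u - u))\<^sup>2)"
    by (intro tendsto_intros fv sub y)
  then have "ereal (limit_value - g u + (- Dg u) \<bullet> (u - u) - 1 / (2 * lam) * (norm (u - u))\<^sup>2) \<le> f u"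
    by (rule LIMSEQ_le_const2) (use prox_subgrad_le in blast)
  with le show "f u = ereal (limit_value - g u)" by simp
qed

lemma H_cluster:
  assumes "w \<in> clusters"
  shows "H w = ereal limit_value"
proof -
  obtain s where s: "strict_mono s" "(\<lambda>j. pair (s j)) \<longlonglongrightarrow> w"
    using assms unfolding clusters_def by blast
  obtain u v where w: "w = (u, v)" by (cases w)
  \<comment> \<open>\<open>merit n\<close> belongs to \<open>pair (Suc n)\<close>, so the index
    drops by one; starting at \<open>s (Suc j)\<close> makes the natural subtraction exact.\<close>
  define t where "t j = s (Suc j) - 1" for j
  have suc: "Suc (t j) = s (Suc j)" and ge: "j \<le> t j" for j
    using seq_suble[OF s(1), of "Suc j"] by (simp_all add: t_def)
  have "filterlim t at_top sequentially"
    by (rule filterlim_at_top_mono[OF filterlim_ident]) (simp add: ge)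
  moreover have "(\<lambda>j. pair (Suc (t j))) \<longlonglongrightarrow> (u, v)"
    unfolding suc using LIMSEQ_Suc[OF s(2)] w by simp
  ultimately have "v = u" "f u = ereal (limit_value - g u)" by (rule accumulation)+
  then show ?thesis by (simp add: w frb_merit_def)
qed

lemma level_value_clusters: "level_value H clusters = limit_value"
  using level_value_eq[OF clusters_nonempty] H_cluster by blast

lemma zero_in_subdiff_limit:
  assumes "pair \<longlonglongrightarrow> (u, u)"
  shows "0 \<in> limiting_subdiff F u"
proof -
  have lim: "(\<lambda>j. pair (Suc j)) \<longlonglongrightarrow> (u, u)" using assms by (rule LIMSEQ_Suc)
  have y: "(\<lambda>j. X (Suc (Suc j))) \<longlonglongrightarrow> u" using tendsto_fst[OF lim] by (simp add: pair_def)
  note acc = accumulation[OF filterlim_ident lim]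
  have "(\<lambda>j. prox_subgrad j + Dg (X (Suc (Suc j)))) \<longlonglongrightarrow> - Dg u + Dg u"
    by (intro tendsto_add acc(3) isCont_tendsto_compose[OF isCont_Dg] y)
  then have "(\<lambda>j. prox_subgrad j + Dg (X (Suc (Suc j)))) \<longlonglongrightarrow> 0" by simp
  moreover have "(\<lambda>j. ereal (fval j + g (X (Suc (Suc j))))) \<longlonglongrightarrow> ereal (limit_value - g u + g u)"
    by (intro tendsto_ereal tendsto_add acc(4) isCont_tendsto_compose[OF isCont_g] y)
  then have "(\<lambda>j. F (X (Suc (Suc j)))) \<longlonglongrightarrow> F u" by (simp add: f_eq_fval acc(2))
  moreover have "F u < \<infinity>" by (simp add: acc(2))
  ultimately show ?thesis
    unfolding limiting_subdiff_def mem_Collect_eq using y subgrad_F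
    by (intro conjI exI[of _ "\<lambda>j. X (Suc (Suc j))"] exI[of _ "\<lambda>j. prox_subgrad j + Dg (X (Suc (Suc j)))"] allI)
qed

lemma two_gap_le:
  assumes desing: "concave_desingularizing H clusters (nbhd \<epsilon> clusters) \<eta> \<phi>"
    and mem: "pair (Suc n) \<in> nbhd \<epsilon> clusters" and small: "ereal (merit n - limit_value) < \<eta>"
    and M: "M = (1 / lam + 2 * L) / (1 / (4 * lam) - L)"
  shows "2 * gap (Suc n) \<le> gap n
    + (M * exact_modulus H clusters \<epsilon> \<eta> (merit n - limit_value)
       - M * exact_modulus H clusters \<epsilon> \<eta> (merit (Suc n) - limit_value))"
proof (cases "merit n = limit_value")
  \<comment> \<open>At the limit value the KL inequality says nothing, but the descent forces the
    next gap to be 0.\<close>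
  case True
  then have eq: "merit (Suc n) = limit_value"
    using merit_Suc_le[of n] limit_value_le_merit[of "Suc n"] by linarith
  have "(1 / (4 * lam) - L) * (gap (Suc n))\<^sup>2 \<le> 0"
    using merit_descent[of n] True eq by linarith
  then have "gap (Suc n) = 0"
    using quarter_step_gt by (simp add: mult_le_0_iff)
  then show ?thesis using gap_nonneg[of n] True eq by simp
next
  case False
  let ?K = "1 / lam + 2 * L" and ?c = "1 / (4 * lam) - L"
  let ?m = "\<lambda>n. exact_modulus H clusters \<epsilon> \<eta> (merit n - limit_value)"
  have K: "0 < ?K" using lam_pos L_pos by (intro add_pos_pos) auto
  have pos: "limit_value < merit n" using False limit_value_le_merit[of n] by linarith
  have H: "H (pair (Suc n)) = ereal (level_value H clusters + (merit n - limit_value))"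
    by (simp add: merit_pair level_value_clusters)
  have slice: "pair (Suc n) \<in> level_slice H clusters (nbhd \<epsilon> clusters) \<eta>"
    unfolding level_slice_iff using mem small pos H by (intro conjI exI[of _ "merit n - limit_value"]) auto
  obtain v where v: "v \<in> limiting_subdiff H (pair (Suc n))" "norm v \<le> ?K * gap n"
    using ex_subgrad_H_le by blast
  note dens = modulus_density_ge[OF desing slice H v(1)]
  \<comment> \<open>The decrease of the merit is thus at most the decrease of the modulus times the
    subgradient norm, while the descent bounds it from below by the squared gap.\<close>
  have le: "1 / norm v * (merit n - merit (Suc n)) \<le> ?m n - ?m (Suc n)"
    using exact_modulus_diff_ge[OF desing, of "merit (Suc n) - limit_value" "merit n - limit_value" "1 / norm v"]
      limit_value_le_merit[of "Suc n"] merit_Suc_le[of n] small dens by simp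
  then have "merit n - merit (Suc n) \<le> (?m n - ?m (Suc n)) * norm v"
    using dens(1) by (simp add: pos_divide_le_eq)
  moreover have diff: "0 \<le> ?m n - ?m (Suc n)"
  proof -
    have "0 \<le> 1 / norm v * (merit n - merit (Suc n))"
      using merit_Suc_le[of n] by (intro mult_nonneg_nonneg) auto
    with le show ?thesis by linarith
  qed
  ultimately have "merit n - merit (Suc n) \<le> (?m n - ?m (Suc n)) * (?K * gap n)"
    using mult_left_mono[OF v(2) diff] by linarith
  then have "?c * (gap (Suc n))\<^sup>2 \<le> (?m n - ?m (Suc n)) * (?K * gap n)"
    using merit_descent[of n] by linarith
  then have "(gap (Suc n))\<^sup>2 \<le> (?m n - ?m (Suc n)) * (?K * gap n) / ?c"
    using quarter_step_gt by (simp only: pos_le_divide_eq mult.commute)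
  also have "\<dots> = gap n * (M * ?m n - M * ?m (Suc n))"
    unfolding M by (simp only: times_divide_eq_left times_divide_eq_right diff_divide_distrib[symmetric])
      (simp add: algebra_simps)
  finally have "(gap (Suc n))\<^sup>2 \<le> gap n * (M * ?m n - M * ?m (Suc n))" .
  moreover have "0 \<le> M * ?m n - M * ?m (Suc n)"
    unfolding M right_diff_distrib[symmetric] using K quarter_step_gt diff by simp
  ultimately show ?thesis by (intro two_mult_le_add_of_sq_le gap_nonneg)
qed

text \<open>The density is positive because \<open>H\<close> takes every value slightly above its limit at points
  \<open>(x\<^sub>k, v)\<close>, where \<open>v\<close> is moved away from \<open>x\<^sub>k\<close>; the iterate \<open>x\<^sub>k\<close> supplies a subgradient there.\<close>

lemma modulus_density_pos:
  assumes desing: "concave_desingularizing H clusters (nbhd \<epsilon> clusters) (ereal e) \<phi>"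
    and lim: "pair \<longlonglongrightarrow> (u, u)" and eps: "0 < \<epsilon>" and e: "64 * lam * e \<le> \<epsilon>\<^sup>2"
    and s: "0 < s" "s < e"
  shows "0 < modulus_density H clusters (nbhd \<epsilon> clusters) (ereal e) s"
proof -
  have lim': "(\<lambda>j. pair (Suc j)) \<longlonglongrightarrow> (u, u)" using lim by (rule LIMSEQ_Suc)
  have y: "(\<lambda>j. X (Suc (Suc j))) \<longlonglongrightarrow> u" using tendsto_fst[OF lim'] by (simp add: pair_def)
  have "(\<lambda>j. fval j + g (X (Suc (Suc j)))) \<longlonglongrightarrow> limit_value - g u + g u"
    by (intro tendsto_add accumulation(4)[OF filterlim_ident lim'] isCont_tendsto_compose[OF isCont_g] y)
  then have "(\<lambda>j. fval j + g (X (Suc (Suc j)))) \<longlonglongrightarrow> limit_value" by simp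
  then have "\<forall>\<^sub>F j in sequentially. dist (fval j + g (X (Suc (Suc j)))) limit_value < s"
    using s(1) by (rule tendstoD)
  moreover have "\<forall>\<^sub>F j in sequentially. dist (X (Suc (Suc j))) u < \<epsilon> / 4"
    using y eps by (intro tendstoD) auto
  ultimately have "\<forall>\<^sub>F j in sequentially. dist (fval j + g (X (Suc (Suc j)))) limit_value < s
      \<and> dist (X (Suc (Suc j))) u < \<epsilon> / 4"
    by (rule eventually_conj)
  then obtain n where n: "dist (fval n + g (X (Suc (Suc n)))) limit_value < s" "dist (X (Suc (Suc n))) u < \<epsilon> / 4"
    using eventually_happens'[OF sequentially_bot] by blast
  let ?y = "X (Suc (Suc n))"
  \<comment> \<open>\<open>r\<close> is what the coupling term must supply for \<open>H\<close> to
    exceed its limit by exactly \<open>s\<close>; with distance \<open>sqrt (4 * lam * r)\<close>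
    the coupling term equals \<open>r\<close>.\<close>
  define r where "r = limit_value + s - (fval n + g ?y)"
  have r: "0 < r" "r < 2 * e" using n(1) s by (auto simp: r_def dist_real_def)
  obtain b :: 'a where "b \<in> Basis" using nonempty_Basis by blast
  then have b: "norm b = 1" by (rule norm_Basis)
  define v where "v = ?y - sqrt (4 * lam * r) *\<^sub>R b"
  have "(sqrt (4 * lam * r))\<^sup>2 = 4 * lam * r" using r lam_pos by simp
  then have norm_sq: "(norm (?y - v))\<^sup>2 = 4 * lam * r" by (simp add: v_def b)
  have "4 * lam * r < 4 * lam * (2 * e)" using r lam_pos by simp
  also have "\<dots> \<le> \<epsilon>\<^sup>2 / 8" using e by simp
  also have "\<dots> \<le> (\<epsilon> / 2)\<^sup>2" by (simp add: power_divide)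
  finally have "norm (?y - v) < \<epsilon> / 2"
    unfolding norm_sq[symmetric] by (rule power2_less_imp_less) (use eps in simp)
  then have "dist v ?y < \<epsilon> / 2" by (simp add: dist_norm norm_minus_commute)
  have "(u, u) \<in> clusters"
    unfolding clusters_def mem_Collect_eq using lim strict_mono_id by (intro exI[of _ id]) simp
  moreover have "dist (u, u) (?y, v) < \<epsilon>"
  proof -
    have "dist (u, u) (?y, v) \<le> dist u ?y + dist u v"
      using sqrt_sum_squares_le_sum[of "dist u ?y" "dist u v"] by (simp add: dist_Pair_Pair)
    also have "\<dots> \<le> dist ?y u + (dist ?y u + dist v ?y)"
      using dist_triangle[of u v ?y] by (simp add: dist_commute)
    finally show ?thesis using n(2) \<open>dist v ?y < \<epsilon> / 2\<close> by linarith
  qed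
  ultimately have mem: "(?y, v) \<in> nbhd \<epsilon> clusters"
    unfolding nbhd_eq_Union_ball by (intro UN_I) auto
  have "1 / (4 * lam) * (norm (?y - v))\<^sup>2 = r" using norm_sq lam_pos by simp
  then have H: "H (?y, v) = ereal (level_value H clusters + s)"
    by (simp add: H_eq f_eq_fval level_value_clusters r_def)
  then have "(?y, v) \<in> level_slice H clusters (nbhd \<epsilon> clusters) (ereal e)"
    unfolding level_slice_iff using mem s by (intro conjI exI[of _ s]) auto
  note dens = modulus_density_ge[OF desing this H subsetD[OF frechet_subdiff_subset_limiting subgrad_H]]
  show ?thesis using dens(1) by (intro less_le_trans[OF _ dens(2)]) (simp only: ennreal_less_zero_iff zero_less_divide_1_iff)
qed

lemma gckl_convergence:
  assumes "has_gckl H clusters"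
  obtains u M N \<epsilon> e where "pair \<longlonglongrightarrow> (u, u)" "summable gap" "0 < M" "0 < \<epsilon>" "0 < e"
    "has_gckl_wrt H clusters (nbhd \<epsilon> clusters) (ereal e)"
    "exact_modulus H clusters \<epsilon> (ereal e) \<in> Phi (ereal e)"
    "\<And>n. N \<le> n \<Longrightarrow> merit n - limit_value < e"
    "\<And>n k. N \<le> n \<Longrightarrow> (\<Sum>j<k. gap (Suc (n + j)))
        \<le> gap n + M * exact_modulus H clusters \<epsilon> (ereal e) (merit n - limit_value)"
proof -
  obtain U \<eta> \<phi> where U: "open U" "clusters \<subseteq> U" "0 < \<eta>" "concave_desingularizing H clusters U \<eta> \<phi>"
    using assms unfolding has_gckl_def has_gckl_wrt_def by blast
  obtain \<epsilon> where eps: "0 < \<epsilon>" "nbhd \<epsilon> clusters \<subseteq> U"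
    using compact_nbhd_subset[OF compact_clusters U(1,2)] .
  \<comment> \<open>The height is made finite and then small against \<open>\<epsilon>\<close>, so
    that the points moved off the sequence in \<open>modulus_density_pos\<close> stay in the
    neighbourhood.\<close>
  obtain \<eta>' where \<eta>': "0 < ereal \<eta>'" "ereal \<eta>' < \<eta>" using ereal_dense2[OF U(3)] by auto
  define e where "e = min \<eta>' (\<epsilon>\<^sup>2 / (64 * lam))"
  have e: "0 < e" "64 * lam * e \<le> \<epsilon>\<^sup>2" "ereal e \<le> \<eta>"
  proof -
    show "0 < e" using \<eta>' eps lam_pos by (simp add: e_def)
    have "e \<le> \<epsilon>\<^sup>2 / (64 * lam)" by (simp add: e_def)
    then show "64 * lam * e \<le> \<epsilon>\<^sup>2" using lam_pos by (simp add: pos_le_divide_eq mult.commute)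
    have "ereal e \<le> ereal \<eta>'" by (simp add: e_def)
    then show "ereal e \<le> \<eta>" using \<eta>'(2) by (meson less_imp_le order_trans)
  qed
  have desing: "concave_desingularizing H clusters (nbhd \<epsilon> clusters) (ereal e) \<phi>"
    by (rule concave_desingularizing_mono[OF U(4) eps(2) e(3)])
  define M where "M = (1 / lam + 2 * L) / (1 / (4 * lam) - L)"
  have "0 < M"
    unfolding M_def using lam_pos L_pos quarter_step_gt by (intro divide_pos_pos add_pos_pos) auto
  define b where "b n = M * exact_modulus H clusters \<epsilon> (ereal e) (merit n - limit_value)" for n
  have "\<forall>\<^sub>F n in sequentially. pair n \<in> nbhd \<epsilon> clusters"
    by (rule eventually_pair_mem[OF open_nbhd subset_nbhd[OF eps(1)]])
  moreover have "\<forall>\<^sub>F n in sequentially. merit n < limit_value + e"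
    using merit_tendsto e(1) by (intro order_tendstoD) auto
  ultimately have "\<forall>\<^sub>F n in sequentially. pair n \<in> nbhd \<epsilon> clusters \<and> merit n < limit_value + e"
    by (rule eventually_conj)
  then obtain N where "\<forall>n\<ge>N. pair n \<in> nbhd \<epsilon> clusters \<and> merit n < limit_value + e"
    unfolding eventually_sequentially by (elim exE)
  note N = this[rule_format]
  have small: "merit n - limit_value < e" if "N \<le> n" for n
    using N[OF that] by linarith
  have sum_le: "(\<Sum>j<k. gap (Suc (n + j))) \<le> gap n + b n" if "N \<le> n" for n k
  proof (rule sum_le_of_two_mult_le[where a = gap and b = b, OF _ that gap_nonneg])
    fix n assume "N \<le> n"
    then show "2 * gap (Suc n) \<le> gap n + (b n - b (Suc n))"
      unfolding b_def using N[of "Suc n"] small[of n]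
      by (intro two_gap_le[OF desing _ _ M_def]) auto
  next
    show "0 \<le> b n" for n
      unfolding b_def using \<open>0 < M\<close> exact_modulus_nonneg[OF desing] by simp
  qed
  have "summable (\<lambda>j. gap (Suc (N + j)))"
    by (rule summableI_nonneg_bounded[OF gap_nonneg sum_le[OF order_refl]])
  then have summable: "summable gap"
    using summable_iff_shift[of gap "Suc N"] by (simp add: add.commute)
  then have "summable (\<lambda>n. pair (Suc n) - pair n)"
    unfolding gap_def by (rule summable_norm_cancel)
  then have "(\<lambda>n. \<Sum>k<n. pair (Suc k) - pair k) \<longlonglongrightarrow> (\<Sum>n. pair (Suc n) - pair n)"
    by (rule summable_LIMSEQ)
  from tendsto_add[OF this tendsto_const[of "pair 0"]] obtain w where w: "pair \<longlonglongrightarrow> w"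
    unfolding sum_lessThan_telescope by auto
  obtain u v where uv: "w = (u, v)" by (cases w)
  have "v = u"
    using accumulation(1)[OF filterlim_ident, of u v] LIMSEQ_Suc[OF w] uv by simp
  with w uv have lim: "pair \<longlonglongrightarrow> (u, u)" by simp
  have "has_gckl_wrt H clusters (nbhd \<epsilon> clusters) (ereal e)"
    unfolding has_gckl_wrt_def using open_nbhd subset_nbhd[OF eps(1)] e(1) desing by auto
  moreover have "exact_modulus H clusters \<epsilon> (ereal e) \<in> Phi (ereal e)"
    using e(1) modulus_density_pos[OF desing lim eps(1) e(2)]
    by (intro exact_modulus_in_Phi[OF desing]) auto
  ultimately show ?thesis
    by (rule that[OF lim summable \<open>0 < M\<close> eps(1) e(1) _ _ small sum_le[unfolded b_def]])
qed

end

section \<open>Finite length and convergence\<close>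

text \<open>Every finite set of integers from \<open>i\<close> on lies in an initial block, so
  bounds on consecutive partial sums bound all finite sums.\<close>

lemma infsum_int_atLeast_le:
  fixes \<psi> :: "int \<Rightarrow> real"
  assumes nonneg: "\<And>k. i \<le> k \<Longrightarrow> 0 \<le> \<psi> k" and bound: "\<And>m. (\<Sum>j<m. \<psi> (i + int j)) \<le> B"
  shows "\<psi> summable_on {i..}" and "infsum \<psi> {i..} \<le> B"
proof -
  have le: "sum \<psi> A \<le> B" if A: "finite A" "A \<subseteq> {i..}" for A
  proof -
    define C where "C = (\<lambda>k. nat (k - i)) ` A"
    have "finite C" using A by (simp add: C_def)
    then obtain m where m: "C \<subseteq> {..<m}" using finite_nat_bounded by blast
    have "A \<subseteq> (\<lambda>j. i + int j) ` {..<m}"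
    proof
      fix k assume "k \<in> A"
      then have "nat (k - i) \<in> {..<m}" "k = i + int (nat (k - i))"
        using m A by (auto simp: C_def)
      then show "k \<in> (\<lambda>j. i + int j) ` {..<m}" by (rule rev_image_eqI)
    qed
    then have "sum \<psi> A \<le> sum \<psi> ((\<lambda>j. i + int j) ` {..<m})"
      using nonneg by (intro sum_mono2) auto
    also have "\<dots> = (\<Sum>j<m. \<psi> (i + int j))"
      by (subst sum.reindex) (auto simp: inj_on_def)
    finally show ?thesis using bound[of m] by linarith
  qed
  then have "bdd_above (sum \<psi> ` {A. A \<subseteq> {i..} \<and> finite A})"
    by (intro bdd_aboveI2[where M = B]) simp
  with nonneg show "\<psi> summable_on {i..}"
    by (intro nonneg_bdd_above_summable_on) auto
  then show "infsum \<psi> {i..} \<le> B"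
    using le by (rule infsum_le_finite_sums)
qed

lemma tendsto_int_at_top:
  assumes "Y \<longlonglongrightarrow> l" and "\<And>n. Y n = y (int n - 1)"
  shows "(y \<longlongrightarrow> l) at_top"
proof -
  have "((\<lambda>k. Y (Suc (nat k))) \<longlongrightarrow> l) at_top"
    by (rule filterlim_compose[OF LIMSEQ_Suc[OF assms(1)] filterlim_nat_sequentially])
  moreover have "\<forall>\<^sub>F k in at_top. Y (Suc (nat k)) = y k"
    using eventually_ge_at_top[of "0 :: int"] by eventually_elim (simp add: assms(2))
  ultimately show ?thesis by (rule Lim_transform_eventually)
qed

lemma limit_points_int_eq:
  assumes "\<And>n. Y n = z (int n - 1)"
  shows "limit_points z = {w. \<exists>s. strict_mono s \<and> (\<lambda>j. Y (s j)) \<longlonglongrightarrow> w}"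
proof (intro equalityI subsetI)
  fix w assume "w \<in> limit_points z"
  then obtain r where r: "strict_mono r" "\<And>j::nat. r j \<ge> -1" "(\<lambda>j. z (r j)) \<longlonglongrightarrow> w"
    unfolding limit_points_def by blast
  define s where "s j = nat (r j + 1)" for j
  have s: "int (s j) - 1 = r j" for j using r(2)[of j] by (simp add: s_def)
  have "strict_mono s"
  proof (rule strict_monoI)
    fix j k :: nat assume "j < k"
    then have "int (s j) < int (s k)" using strict_monoD[OF r(1)] s by (smt (verit))
    then show "s j < s k" by simp
  qed
  then show "w \<in> {w. \<exists>s. strict_mono s \<and> (\<lambda>j. Y (s j)) \<longlonglongrightarrow> w}"
    using r(3) unfolding mem_Collect_eq assms by (intro exI[of _ s]) (simp add: s)
next
  fix w assume "w \<in> {w. \<exists>s. strict_mono s \<and> (\<lambda>j. Y (s j)) \<longlonglongrightarrow> w}"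
  then obtain s :: "nat \<Rightarrow> nat" where "strict_mono s" "(\<lambda>j. Y (s j)) \<longlonglongrightarrow> w" by blast
  then show "w \<in> limit_points z"
    unfolding limit_points_def mem_Collect_eq assms
    by (intro exI[of _ "\<lambda>j. int (s j) - 1"]) (auto simp: strict_mono_def)
qed

theorem theorem3p9:
  fixes f :: "'a::euclidean_space \<Rightarrow> ereal"
    and g :: "'a \<Rightarrow> real" and Dg :: "'a \<Rightarrow> 'a"
    and L lam :: real
    and x :: "int \<Rightarrow> 'a" and z :: "int \<Rightarrow> 'a \<times> 'a"
    and F :: "'a \<Rightarrow> ereal" and H :: "'a \<times> 'a \<Rightarrow> ereal" and \<omega> :: "('a \<times> 'a) set"
  defines "F \<equiv> \<lambda>u. f u + ereal (g u)"
    and "H \<equiv> frb_merit f g lam"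
    and "z \<equiv> \<lambda>k. (x (k + 1), x k)"
    and "\<omega> \<equiv> limit_points z"
  assumes "proper f" and "lsc f" and "prox_bounded f" and "prox_threshold f > 0"
    and "\<And>u. GDERIV g u :> Dg u" and "L > 0" and "L-lipschitz_on UNIV Dg"
    and "(INF u. F u) > -\<infinity>"
    and "0 < lam" and "ereal lam < min (ereal (1 / (4 * L))) (prox_threshold f)"
    and "frb_sequence f Dg lam x"
    and "bounded (z ` {-1..})"
    and "has_gckl H \<omega>"
  shows
    "(Cauchy (\<lambda>j::nat. z (int j - 1)) \<and>
      (\<lambda>k. norm (z (k + 1) - z k)) summable_on {-1..} \<and>
      (\<exists>zs. (z \<longlongrightarrow> zs) at_top \<and>
        (\<exists>(M::real) (k\<^sub>0::nat) (\<epsilon>::real) (\<eta>::ereal).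
           M > 0 \<and> \<epsilon> > 0 \<and> \<eta> > 0 \<and>
           has_gckl_wrt H \<omega> (nbhd \<epsilon> \<omega>) \<eta> \<and>
           exact_modulus H \<omega> \<epsilon> \<eta> \<in> Phi \<eta> \<and>
           (\<forall>i \<ge> int k\<^sub>0 + 1.
              0 \<le> H (z i) - H zs \<and> H (z i) - H zs < \<eta> \<and>
              (\<Sum>\<^sub>\<infinity>k\<in>{i..}. norm (z (k + 1) - z k))
                \<le> norm (z i - z (i - 1))
                   + M * exact_modulus H \<omega> \<epsilon> \<eta> (real_of_ereal (H (z i) - H zs)))))) \<and>
     (\<lambda>k. norm (x (k + 1) - x k)) summable_on {-1..} \<and>
     (\<exists>xs. (x \<longlongrightarrow> xs) at_top \<and> 0 \<in> limiting_subdiff F xs)"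
proof -
  define X where "X n = x (int n - 1)" for n
  have step: "X (Suc (Suc n)) \<in> prox lam f (X (Suc n) + lam *\<^sub>R (Dg (X n) - 2 *\<^sub>R Dg (X (Suc n))))" for n
  proof -
    have "x (int n + 1) \<in> prox lam f
        (x (int n) + lam *\<^sub>R (Dg (x (int n - 1)) - Dg (x (int n))) - lam *\<^sub>R Dg (x (int n)))"
      using \<open>frb_sequence f Dg lam x\<close> unfolding frb_sequence_def Let_def by simp
    moreover have "u + lam *\<^sub>R (v - w) - lam *\<^sub>R w = u + lam *\<^sub>R (v - 2 *\<^sub>R w)" for u v w :: 'a
      by (simp add: scaleR_2 scaleR_diff_right scaleR_add_right)
    ultimately show ?thesis by (simp add: X_def add.commute)
  qed
  have below: "\<exists>m. \<forall>u. ereal m \<le> f u + ereal (g u)"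
  proof -
    obtain m where "ereal m < (INF u. F u)"
      using ereal_dense2[OF \<open>(INF u. F u) > -\<infinity>\<close>] by blast
    then have "ereal m \<le> F u" for u by (meson INF_lower UNIV_I less_imp_le order_trans)
    then show ?thesis unfolding F_def by blast
  qed
  have range: "range (\<lambda>n. (X (Suc n), X n)) \<subseteq> z ` {-1..}"
  proof
    fix w assume "w \<in> range (\<lambda>n. (X (Suc n), X n))"
    then obtain n where "w = (X (Suc n), X n)" by blast
    then have "w = z (int n - 1)" by (simp add: X_def z_def)
    then show "w \<in> z ` {-1..}" by (rule image_eqI) simp
  qed
  have "lam < 1 / (4 * L)" using \<open>ereal lam < _\<close> by simp
  then have size: "4 * lam * L < 1" using \<open>L > 0\<close> by (simp add: field_simps)
  interpret frb_iteration f g Dg L lam X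
    by unfold_locales (fact assms step below size bounded_subset[OF \<open>bounded (z ` {-1..})\<close> range])+
  have pair: "pair n = z (int n - 1)" for n by (simp add: pair_def z_def X_def)
  have \<omega>: "\<omega> = clusters" unfolding \<omega>_def clusters_def by (intro limit_points_int_eq pair)
  obtain u M N \<epsilon> e where lim: "pair \<longlonglongrightarrow> (u, u)" and sum_gap: "summable gap" and pos: "0 < M" "0 < \<epsilon>" "0 < e"
    and gckl: "has_gckl_wrt H \<omega> (nbhd \<epsilon> \<omega>) (ereal e)"
    and Phi: "exact_modulus H \<omega> \<epsilon> (ereal e) \<in> Phi (ereal e)"
    and small: "\<And>n. N \<le> n \<Longrightarrow> merit n - limit_value < e"
    and length: "\<And>n k. N \<le> n \<Longrightarrow> (\<Sum>j<k. gap (Suc (n + j)))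
        \<le> gap n + M * exact_modulus H \<omega> \<epsilon> (ereal e) (merit n - limit_value)"
    using gckl_convergence \<open>has_gckl H \<omega>\<close> unfolding \<omega> H_def by metis
  have gap: "norm (z (k + 1) - z k) = gap n" if "k = int n - 1" for k n
    by (simp add: gap_def pair that add.commute)
  have "norm (z (-1 + int j + 1) - z (-1 + int j)) = gap j" for j
    by (rule gap) simp
  then have "(\<Sum>j<m. norm (z (-1 + int j + 1) - z (-1 + int j))) \<le> suminf gap" for m
    using sum_le_suminf[OF sum_gap, of "{..<m}"] gap_nonneg by (simp only:) simp
  then have summable_z: "(\<lambda>k. norm (z (k + 1) - z k)) summable_on {-1..}"
    by (intro infsum_int_atLeast_le(1)) auto
  have H_u: "H (u, u) = ereal limit_value"
  proof -
    have "(u, u) \<in> clusters"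
      unfolding clusters_def mem_Collect_eq using lim strict_mono_id by (intro exI[of _ id]) simp
    then show ?thesis unfolding H_def by (rule H_cluster)
  qed
  have H_z: "H (z i) = ereal (merit (nat i))" if "0 \<le> i" for i
    using merit_pair[of "nat i"] that by (simp add: pair H_def)
  have tail: "0 \<le> H (z i) - H (u, u) \<and> H (z i) - H (u, u) < ereal e \<and>
      (\<Sum>\<^sub>\<infinity>k\<in>{i..}. norm (z (k + 1) - z k))
        \<le> norm (z i - z (i - 1)) + M * exact_modulus H \<omega> \<epsilon> (ereal e) (real_of_ereal (H (z i) - H (u, u)))"
    if i: "int N + 1 \<le> i" for i
  proof -
    \<comment> \<open>\<open>z i\<close> is \<open>pair (Suc (nat i))\<close>, whose merit value is
      \<open>merit (nat i)\<close>, and its distance to \<open>z (i - 1)\<close> is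
      \<open>gap (nat i)\<close>.\<close>
    have n: "N \<le> nat i" "0 \<le> i" using i by auto
    have eq: "H (z i) - H (u, u) = ereal (merit (nat i) - limit_value)"
      using n by (simp add: H_z H_u)
    have "norm (z i - z (i - 1)) = gap (nat i)"
      using gap[of "i - 1" "nat i"] n by simp
    moreover have "(\<Sum>\<^sub>\<infinity>k\<in>{i..}. norm (z (k + 1) - z k))
        \<le> gap (nat i) + M * exact_modulus H \<omega> \<epsilon> (ereal e) (merit (nat i) - limit_value)"
    proof (rule infsum_int_atLeast_le(2))
      fix m
      have "norm (z (i + int j + 1) - z (i + int j)) = gap (Suc (nat i + j))" for j
        using n by (intro gap) simp
      then show "(\<Sum>j<m. norm (z (i + int j + 1) - z (i + int j)))
          \<le> gap (nat i) + M * exact_modulus H \<omega> \<epsilon> (ereal e) (merit (nat i) - limit_value)"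
        using length[OF n(1), of m] by simp
    qed simp
    ultimately show ?thesis
      unfolding eq using small[OF n(1)] limit_value_le_merit[of "nat i"] by simp
  qed
  have "(\<lambda>k. norm (x (k + 1) - x k)) summable_on {-1..}"
  \<comment> \<open>The increment of \<open>x\<close> is the second component of the increment of
    \<open>z\<close>.\<close>
  proof (rule summable_on_comparison_test[OF summable_z])
    show "norm (x (k + 1) - x k) \<le> norm (z (k + 1) - z k)" for k
      using norm_snd_le[of "x (k + 1) - x k" "x (k + 1 + 1) - x (k + 1)"] by (simp add: z_def)
  qed simp
  moreover have "(x \<longlongrightarrow> u) at_top"
    using tendsto_snd[OF lim] by (intro tendsto_int_at_top) (simp_all add: pair_def X_def)
  moreover have "0 \<in> limiting_subdiff F u"
    unfolding F_def by (rule zero_in_subdiff_limit[OF lim])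
  moreover have "Cauchy (\<lambda>j::nat. z (int j - 1))"
    using LIMSEQ_imp_Cauchy[OF lim] by (simp add: pair[abs_def])
  moreover have "(z \<longlongrightarrow> (u, u)) at_top"
    using lim pair by (rule tendsto_int_at_top)
  moreover have "ereal e > 0" using pos by simp
  ultimately show ?thesis
    using summable_z pos gckl Phi tail by blast
qed

end
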